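(* Let $k$ be an odd integer with $k\ge 5$, let $D$ be a strong $k$-quasi-transitive digraph with $\mathrm{diam}(D)\ge k+2$, let $u,v\in V(D)$ with $d(u,v)=k+2$, and let $P$ be a shortest $(u,v)$-path in $D$. Then $D[V(D)\setminus V(P)]$ is either a semicomplete digraph, a semicomplete bipartite digraph, or an empty digraph.
   Context: All digraphs are finite, without loops or multiple arcs (opposite arcs allowed). Vertices $x,y$ are adjacent if $xy$ or $yx$ is an arc. For $k\ge 2$, $D$ is $k$-quasi-transitive if for every path $x_0x_1\ldots x_k$ of length $k$, $x_0$ and $x_k$ are adjacent. $d(x,y)$ is the length of a shortest $(x,y)$-path, $\mathrm{diam}(D)=\max_{x,y}d(x,y)$. $D[S]$ is the induced subdigraph. A semicomplete digraph: every two distinct vertices adjacent. A semicomplete bipartite digraph: there is a bipartition $(X,Y)$ of the vertex set with no arcs inside $X$ or $Y$ and every vertex of $X$ adjacent to every vertex of $Y$. An empty digraph is one with no arcs. *)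

theory Defs
  imports Main
begin

definition digraph :: "'a set \<Rightarrow> ('a \<times> 'a) set \<Rightarrow> bool" where
  "digraph V A \<longleftrightarrow> finite V \<and> A \<subseteq> V \<times> V \<and> (\<forall>x. (x, x) \<notin> A)"

definition adjacent :: "('a \<times> 'a) set \<Rightarrow> 'a \<Rightarrow> 'a \<Rightarrow> bool" where
  "adjacent A x y \<longleftrightarrow> (x, y) \<in> A \<or> (y, x) \<in> A"

definition is_path :: "('a \<times> 'a) set \<Rightarrow> 'a list \<Rightarrow> bool" where
  "is_path A p \<longleftrightarrow> p \<noteq> [] \<and> distinct p \<and> (\<forall>i. Suc i < length p \<longrightarrow> (p ! i, p ! Suc i) \<in> A)"

definition path_len :: "'a list \<Rightarrow> nat" where
  "path_len p = length p - 1"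

definition is_path_from_to :: "('a \<times> 'a) set \<Rightarrow> 'a \<Rightarrow> 'a \<Rightarrow> 'a list \<Rightarrow> bool" where
  "is_path_from_to A x y p \<longleftrightarrow> is_path A p \<and> hd p = x \<and> last p = y"

definition k_quasi_transitive :: "nat \<Rightarrow> 'a set \<Rightarrow> ('a \<times> 'a) set \<Rightarrow> bool" where
  "k_quasi_transitive k V A \<longleftrightarrow>
     (\<forall>p. is_path A p \<and> path_len p = k \<longrightarrow> adjacent A (hd p) (last p))"

definition strong :: "'a set \<Rightarrow> ('a \<times> 'a) set \<Rightarrow> bool" where
  "strong V A \<longleftrightarrow> (\<forall>x\<in>V. \<forall>y\<in>V. \<exists>p. is_path_from_to A x y p)"

definition dist :: "('a \<times> 'a) set \<Rightarrow> 'a \<Rightarrow> 'a \<Rightarrow> nat" where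
  "dist A x y = (LEAST n. \<exists>p. is_path_from_to A x y p \<and> path_len p = n)"

definition diam :: "'a set \<Rightarrow> ('a \<times> 'a) set \<Rightarrow> nat" where
  "diam V A = Max {dist A x y | x y. x \<in> V \<and> y \<in> V}"

definition is_shortest_path :: "('a \<times> 'a) set \<Rightarrow> 'a \<Rightarrow> 'a \<Rightarrow> 'a list \<Rightarrow> bool" where
  "is_shortest_path A x y p \<longleftrightarrow> is_path_from_to A x y p \<and> path_len p = dist A x y"

definition induced_arcs :: "('a \<times> 'a) set \<Rightarrow> 'a set \<Rightarrow> ('a \<times> 'a) set" where
  "induced_arcs A S = A \<inter> (S \<times> S)"

definition semicomplete :: "'a set \<Rightarrow> ('a \<times> 'a) set \<Rightarrow> bool" where
  "semicomplete V A \<longleftrightarrow> (\<forall>x\<in>V. \<forall>y\<in>V. x \<noteq> y \<longrightarrow> adjacent A x y)"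

definition semicomplete_bipartite :: "'a set \<Rightarrow> ('a \<times> 'a) set \<Rightarrow> bool" where
  "semicomplete_bipartite V A \<longleftrightarrow>
     (\<exists>X Y. X \<union> Y = V \<and> X \<inter> Y = {} \<and> X \<noteq> {} \<and> Y \<noteq> {} \<and>
        (\<forall>x\<in>X. \<forall>x'\<in>X. \<not> adjacent A x x') \<and>
        (\<forall>y\<in>Y. \<forall>y'\<in>Y. \<not> adjacent A y y') \<and>
        (\<forall>x\<in>X. \<forall>y\<in>Y. adjacent A x y))"

definition empty_digraph :: "'a set \<Rightarrow> ('a \<times> 'a) set \<Rightarrow> bool" where
  "empty_digraph V A \<longleftrightarrow> A = {}"

end

theory Submission
  imports Defs
begin

text \<open>
  Let \<open>P = x\<^sub>0 \<dots> x\<^sub>k\<^sub>+\<^sub>2\<close>. The paths of length \<open>k\<close> inside \<open>P\<close> force the arc \<open>x\<^sub>k\<^sub>+\<^sub>2 x\<^sub>0\<close>, so \<open>P\<close> spans a cycle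
  of even length \<open>k + 3\<close>. Prolonging along this cycle, every vertex outside \<open>P\<close> is adjacent to some \<open>x\<^sub>i\<close>;
  the parity of \<open>i\<close> is its type, and some vertices may have both types. Vertices of opposite types are
  adjacent: unless both send arcs only to \<open>P\<close> or both receive arcs only from \<open>P\<close>, a path of length
  \<open>k\<close> between them runs through \<open>P\<close>, and the exceptional cases follow by induction on the distance to
  (or, dually, from) \<open>P\<close>. If no vertex has both types, adjacent outside vertices have opposite types, and
  the types give the bipartition (or no arcs at all). If some vertex has both types, then some
  \<open>y\<close> outside \<open>P\<close> has arcs \<open>x\<^sub>j y\<close> and \<open>y x\<^sub>i\<close> with \<open>i + j\<close> odd; detours through \<open>y\<close> change parity, so
  every vertex has both types and the outside is semicomplete. Reversing all arcs and reading \<open>P\<close>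
  backwards exchanges the two types, which halves the case analysis.
\<close>

section \<open>The setting and its reversal\<close>

lemma relpow_converse: "((R :: ('a \<times> 'a) set)\<inverse>) ^^ n = (R ^^ n)\<inverse>"
  by (induction n) (simp_all add: converse_relcomp[symmetric] relpow_commute)

text \<open>The assumptions are stable under reversing all arcs and reading \<open>x\<close>
  backwards. \<open>geodesic\<close> speaks of walks, so short detours contradict it without being
  made into paths.\<close>

locale long_geodesic =
  fixes V :: "'a set" and A :: "('a \<times> 'a) set" and k :: nat and x :: "nat \<Rightarrow> 'a"
  assumes arcs_V: "A \<subseteq> V \<times> V"
    and odd_k: "odd k" and k5: "5 \<le> k"
    and x_V: "i \<le> k + 2 \<Longrightarrow> x i \<in> V"
    and x_arc: "i < k + 2 \<Longrightarrow> (x i, x (Suc i)) \<in> A"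
    and geodesic: "i \<le> k + 2 \<Longrightarrow> j \<le> k + 2 \<Longrightarrow> (x i, x j) \<in> A ^^ n \<Longrightarrow> j \<le> i + n"
    and kqt: "distinct l \<Longrightarrow> successively (\<lambda>a b. (a, b) \<in> A) l \<Longrightarrow> length l = Suc k
      \<Longrightarrow> adjacent A (hd l) (last l)"
    and strongly: "a \<in> V \<Longrightarrow> b \<in> V \<Longrightarrow> (a, b) \<in> A\<^sup>*"
begin

abbreviation P :: "'a set" where "P \<equiv> x ` {..k + 2}"
abbreviation W :: "'a set" where "W \<equiv> V - P"
abbreviation dipath :: "'a list \<Rightarrow> bool" where
  "dipath l \<equiv> distinct l \<and> successively (\<lambda>a b. (a, b) \<in> A) l"

definition seg :: "nat \<Rightarrow> nat \<Rightarrow> 'a list" where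
  "seg i j = map x [i..<Suc j]"

text \<open>The parity class is the residue of \<open>p\<close> modulo 2. One neighbour in the class is enough: a vertex
  outside \<open>P\<close> need not be adjacent to the whole class, for instance when \<open>k = 7\<close>.\<close>

definition parity_type :: "nat \<Rightarrow> 'a \<Rightarrow> bool" where
  "parity_type p y \<longleftrightarrow> (\<exists>i\<le>k + 2. even (i + p) \<and> adjacent A y (x i))"

lemma adj_sym: "adjacent A a b \<Longrightarrow> adjacent A b a"
  by (auto simp: adjacent_def)

lemma parity_type_cong: "even (p + q) \<Longrightarrow> parity_type p y = parity_type q y"
  by (auto simp: parity_type_def)

lemma dual: "long_geodesic V (A\<inverse>) k (\<lambda>i. x (k + 2 - i))"
proof
  show "A\<inverse> \<subseteq> V \<times> V" using arcs_V by auto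
  show "odd k" "5 \<le> k" by (fact odd_k k5)+
  show "x (k + 2 - i) \<in> V" for i by (rule x_V) simp
  show "(x (k + 2 - i), x (k + 2 - Suc i)) \<in> A\<inverse>" if "i < k + 2" for i
    using x_arc[of "k + 2 - Suc i"] that Suc_diff_Suc[of i "k + 2"] by simp
  show "j \<le> i + n" if "i \<le> k + 2" "j \<le> k + 2" "(x (k + 2 - i), x (k + 2 - j)) \<in> A\<inverse> ^^ n" for i j n
    using geodesic[of "k + 2 - j" "k + 2 - i" n] that by (simp add: relpow_converse)
  show "adjacent (A\<inverse>) (hd l) (last l)"
    if "distinct l" "successively (\<lambda>a b. (a, b) \<in> A\<inverse>) l" "length l = Suc k" for l
    using kqt[of "rev l"] that by (auto simp: hd_rev last_rev adjacent_def)
  show "(a, b) \<in> (A\<inverse>)\<^sup>*" if "a \<in> V" "b \<in> V" for a b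
    using strongly[OF that(2,1)] by (simp add: rtrancl_converse)
qed

lemma dual_P: "(\<lambda>i. x (k + 2 - i)) ` {..k + 2} = P"
proof -
  have "(\<lambda>i. x (k + 2 - i)) ` {..k + 2} = x ` ((\<lambda>i. k + 2 - i) ` {..k + 2})"
    by (simp add: image_image)
  moreover have "(\<lambda>i. k + 2 - i) ` {..k + 2} = {..k + 2}"
  proof safe
    fix i assume "i \<le> k + 2"
    then show "i \<in> (\<lambda>i. k + 2 - i) ` {..k + 2}" by (intro image_eqI[of _ _ "k + 2 - i"]) auto
  qed auto
  ultimately show ?thesis by simp
qed

text \<open>\<open>k + 2\<close> is odd, so \<open>i\<close> and \<open>k + 2 - i\<close> have
  opposite parities.\<close>

lemma dual_parity_type: "long_geodesic.parity_type (A\<inverse>) k (\<lambda>i. x (k + 2 - i)) p y = parity_type (Suc p) y"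
proof -
  have *: "even (k + 2 - i + p) = even (i + Suc p)" if "i \<le> k + 2" for i
    using that odd_k by auto
  show ?thesis
    unfolding long_geodesic.parity_type_def[OF dual] parity_type_def
  proof safe
    fix i assume i: "i \<le> k + 2" "even (i + p)" "adjacent (A\<inverse>) y (x (k + 2 - i))"
    then show "\<exists>i\<le>k + 2. even (i + Suc p) \<and> adjacent A y (x i)"
      using odd_k by (intro exI[of _ "k + 2 - i"]) (auto simp: adjacent_def)
  next
    fix i assume i: "i \<le> k + 2" "even (i + Suc p)" "adjacent A y (x i)"
    then show "\<exists>i\<le>k + 2. even (i + p) \<and> adjacent (A\<inverse>) y (x (k + 2 - i))"
      using odd_k by (intro exI[of _ "k + 2 - i"]) (auto simp: adjacent_def)
  qed
qed

section \<open>The cycle on \<open>P\<close> and the types it yields\<close>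

lemma kpath_adj:
  assumes "dipath l" "length l = Suc k" "hd l = a" "last l = b"
  shows "adjacent A a b"
  using kqt[of l] assms by auto

lemma x_eq_iff [simp]: "i \<le> k + 2 \<Longrightarrow> j \<le> k + 2 \<Longrightarrow> x i = x j \<longleftrightarrow> i = j"
  using geodesic[of i j 0] geodesic[of j i 0] by auto

lemma arc_forward: "i \<le> k + 2 \<Longrightarrow> j \<le> k + 2 \<Longrightarrow> (x i, x j) \<in> A \<Longrightarrow> j \<le> Suc i"
  using geodesic[of i j 1] by simp

lemma
  shows seg_distinct: "j \<le> k + 2 \<Longrightarrow> distinct (seg i j)"
    and seg_arcs: "j \<le> k + 2 \<Longrightarrow> successively (\<lambda>a b. (a, b) \<in> A) (seg i j)"
    and seg_length: "length (seg i j) = Suc j - i"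
    and seg_Nil: "seg i j = [] \<longleftrightarrow> j < i"
    and seg_hd: "i \<le> j \<Longrightarrow> hd (seg i j) = x i"
    and seg_last: "i \<le> j \<Longrightarrow> last (seg i j) = x j"
    and set_seg: "set (seg i j) = x ` {i..j}"
proof -
  show "distinct (seg i j)" if "j \<le> k + 2"
    using that by (auto simp: seg_def distinct_map inj_on_def)
  show "successively (\<lambda>a b. (a, b) \<in> A) (seg i j)" if "j \<le> k + 2"
    using that by (auto simp: seg_def successively_map successively_conv_nth x_arc simp del: upt_Suc)
  show "set (seg i j) = x ` {i..j}"
    by (auto simp: seg_def simp del: upt_Suc)
  show "i \<le> j \<Longrightarrow> hd (seg i j) = x i" by (auto simp: seg_def hd_map simp del: upt_Suc)
  show "i \<le> j \<Longrightarrow> last (seg i j) = x j" by (auto simp: seg_def last_map)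
qed (auto simp: seg_def simp del: upt_Suc)

lemma seg_mem: "j \<le> k + 2 \<Longrightarrow> a \<le> k + 2 \<Longrightarrow> x a \<in> x ` {i..j} \<longleftrightarrow> i \<le> a \<and> a \<le> j"
  by auto

lemma seg_disj: "j \<le> k + 2 \<Longrightarrow> j' \<le> k + 2 \<Longrightarrow> j < i' \<or> j' < i \<Longrightarrow> x ` {i..j} \<inter> x ` {i'..j'} = {}"
  by auto

lemmas seg_simps = seg_distinct seg_arcs seg_length seg_Nil seg_hd seg_last set_seg seg_mem
  seg_disj successively_Cons successively_append_iff

text \<open>The first \<open>k + 1\<close> vertices of \<open>P\<close> form a path of length
  \<open>k\<close>, so its ends are adjacent; a forward arc would shorten \<open>P\<close>. The next
  two lemmas shift this segment.\<close>

lemma chord_0: "(x k, x 0) \<in> A"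
proof -
  have "adjacent A (x 0) (x k)"
    by (rule kpath_adj[of "seg 0 k"]) (auto simp: seg_simps)
  then show ?thesis using arc_forward[of 0 k] k5 by (auto simp: adjacent_def)
qed

lemma chord_1: "(x (Suc k), x (Suc 0)) \<in> A"
proof -
  have "adjacent A (x 1) (x (k + 1))"
    by (rule kpath_adj[of "seg 1 (k + 1)"]) (auto simp: seg_simps)
  then show ?thesis using arc_forward[of 1 "k + 1"] k5 by (auto simp: adjacent_def)
qed

lemma chord_2: "(x (Suc (Suc k)), x 2) \<in> A"
proof -
  have "adjacent A (x 2) (x (k + 2))"
    by (rule kpath_adj[of "seg 2 (k + 2)"]) (auto simp: seg_simps)
  then show ?thesis using arc_forward[of 2 "k + 2"] k5 by (auto simp: adjacent_def)
qed

lemma chord_wrap: "(x (Suc (Suc k)), x 0) \<in> A"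
proof -
  have "adjacent A (x (k + 2)) (x 0)"
    using k5
    by (intro kpath_adj[of "x (k + 2) # seg 2 k @ [x 0]"]) (simp_all add: seg_simps chord_2 chord_0)
  then show ?thesis using arc_forward[of 0 "k + 2"] k5 by (auto simp: adjacent_def)
qed

lemmas chords = chord_0 chord_1 chord_2 chord_wrap

text \<open>The cycle has even length \<open>k + 3\<close>, so passing from \<open>x (k + 2)\<close>
  to \<open>x 0\<close> does not disturb the parity count; at most \<open>k + 2\<close> steps repeat
  no vertex.\<close>

lemma cycle_list:
  assumes "c \<le> k + 2" "s \<le> k + 2"
  obtains l c' where "dipath l" "length l = Suc s" "hd l = x c" "last l = x c'" "set l \<subseteq> P"
    "c' \<le> k + 2" "even (c + s + c')"
proof -
  define g where "g t = (if c + t \<le> k + 2 then c + t else c + t - (k + 3))" for t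
  have g_le: "g t \<le> k + 2" if "t \<le> s" for t
    using that assms by (auto simp: g_def)
  have g_arc: "(x (g t), x (g (Suc t))) \<in> A" if "t < s" for t
  proof (cases "g t = k + 2")
    case True
    then have "g (Suc t) = 0" using that assms unfolding g_def by (auto split: if_splits)
    then show ?thesis using True chords by simp
  next
    case False
    then have "g (Suc t) = Suc (g t)" using that assms unfolding g_def by (auto split: if_splits)
    then show ?thesis using x_arc[of "g t"] g_le[of t] False that by simp
  qed
  have g_inj: "inj_on (\<lambda>t. x (g t)) {0..<Suc s}"
  proof (rule inj_onI)
    fix t t' assume t: "t \<in> {0..<Suc s}" "t' \<in> {0..<Suc s}" "x (g t) = x (g t')"
    then have "g t = g t'" using g_le x_eq_iff by (meson atLeastLessThan_iff less_Suc_eq_le)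
    then show "t = t'" using t assms unfolding g_def by (auto split: if_splits)
  qed
  let ?l = "map (\<lambda>t. x (g t)) [0..<Suc s]"
  show thesis
  proof (rule that[of ?l "g s"])
    show "dipath ?l"
      using g_inj g_arc
      by (simp add: distinct_map successively_map successively_conv_nth del: upt_Suc)
    show "hd ?l = x c" using assms by (simp add: hd_map g_def del: upt_Suc)
    show "even (c + s + g s)" using odd_k assms unfolding g_def by auto
  qed (use g_le in auto)
qed

text \<open>The arc to \<open>x c\<close> and \<open>k - length q\<close> further arcs of the cycle
  prolong \<open>q\<close> to a path of length \<open>k\<close>.\<close>

lemma out_type:
  assumes q: "dipath q" "set q \<inter> P = {}" "q \<noteq> []" "length q \<le> k" and c: "c \<le> k + 2" "(last q, x c) \<in> A"
  shows "parity_type (c + k + length q) (hd q)"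
proof -
  have "k - length q \<le> k + 2" by simp
  from cycle_list[OF c(1) this]
  obtain l c' where l: "dipath l" "length l = Suc (k - length q)" "hd l = x c" "last l = x c'"
    "set l \<subseteq> P" "c' \<le> k + 2" "even (c + (k - length q) + c')" .
  have "l \<noteq> []" using l by auto
  then have "adjacent A (hd q) (x c')"
    using l q c by (intro kpath_adj[of "q @ l"]) (auto simp: successively_append_iff)
  then show ?thesis using l q unfolding parity_type_def by (intro exI[of _ c']) auto
qed


lemma in_type:
  assumes q: "dipath q" "set q \<inter> P = {}" "q \<noteq> []" "length q \<le> k" and c: "c \<le> k + 2" "(x c, hd q) \<in> A"
  shows "parity_type (c + k + length q) (last q)"
proof -
  have "long_geodesic.parity_type (A\<inverse>) k (\<lambda>i. x (k + 2 - i)) (k + 2 - c + k + length q) (last q)"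
    using long_geodesic.out_type[OF dual, of "rev q" "k + 2 - c"] q c
    by (auto simp: dual_P[simplified] hd_rev last_rev)
  then show ?thesis
    \<comment> \<open>Reversal flips the parity of \<open>c\<close>, and
      \<open>dual_parity_type\<close> flips the class back.\<close>
    unfolding dual_parity_type using c odd_k by (subst parity_type_cong[of _ "Suc (k + 2 - c + k + length q)"]) auto
qed


lemma outside:
  assumes "y \<notin> P"
  shows "j \<le> k + 2 \<Longrightarrow> y \<notin> x ` {i..j}" "j \<le> k + 2 \<Longrightarrow> y \<noteq> x j" "j \<le> k + 2 \<Longrightarrow> x j \<noteq> y"
  using assms by auto

subsection \<open>Neighbours of an outside vertex on the geodesic\<close>

lemma gap:
  assumes "i \<le> k + 2" "j \<le> k + 2" "(y, x i) \<in> A" "(x j, y) \<in> A"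
  shows "i \<le> j + 2"
  using geodesic[of j i 2] assms by (auto simp: numeral_2_eq_2)

text \<open>Going round the cycle from \<open>x i\<close> to \<open>x (i - 2)\<close> makes the path
  from \<open>y\<close> two arcs too long. Each case skips two vertices by a chord that spares both
  of these ends.\<close>

lemma out_minus_2:
  assumes y: "y \<notin> P" and i: "2 \<le> i" "i \<le> k + 2" "(y, x i) \<in> A"
  shows "adjacent A y (x (i - 2))"
proof -
  consider "i = 2" | "3 \<le> i" "i \<le> k + 1" | "i = k + 2" using i by linarith
  then show ?thesis
  proof cases
    case 1
    then show ?thesis using i k5
      by (intro kpath_adj[of "y # seg 2 k @ [x 0]"]) (simp_all add: seg_simps outside[OF y] chords)
  next
    case 2
    then show ?thesis using i k5
      by (intro kpath_adj[of "y # seg i (k + 1) @ seg 1 (i - 2)"])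
        (simp_all add: seg_simps outside[OF y] chords)
  next
    case 3
    then show ?thesis using i k5
      by (intro kpath_adj[of "y # x (k + 2) # seg 2 k"])
        (simp_all add: seg_simps outside[OF y] chords)
  qed
qed

lemma out_minus_4:
  assumes y: "y \<notin> P" and i: "4 \<le> i" "i \<le> k + 2" "(y, x i) \<in> A"
  shows "adjacent A y (x (i - 4))"
  using i k5
  by (intro kpath_adj[of "y # seg i (k + 2) @ seg 0 (i - 4)"])
    (simp_all add: seg_simps outside[OF y] chords)

text \<open>Modulo \<open>k + 3\<close> the index \<open>i + k - 1\<close> is \<open>i - 4\<close>,
  so this continues \<open>out_minus_4\<close> below index 4.\<close>

lemma out_wrap:
  assumes y: "y \<notin> P" and i: "i < 4" "(y, x i) \<in> A"
  shows "adjacent A y (x (i + k - 1))"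
  using i k5
  by (intro kpath_adj[of "y # seg i (i + k - 1)"])
    (simp_all add: seg_simps outside[OF y] chords)

text \<open>The descent goes by twos along out-arcs. If it meets only an in-arc from
  \<open>x (i - 2)\<close>, then \<open>gap\<close> excludes an in-arc from
  \<open>x (i - 4)\<close>, so the descent resumes there.\<close>

lemma out_down:
  assumes y: "y \<notin> P"
  shows "i \<le> k + 2 \<Longrightarrow> (y, x i) \<in> A \<Longrightarrow> j \<le> i \<Longrightarrow> even (i + j) \<Longrightarrow> adjacent A y (x j)"
proof (induction i rule: less_induct)
  case (less i)
  show ?case
  proof (cases "j = i")
    case True
    then show ?thesis using less by (simp add: adjacent_def)
  next
    case False
    then have j2: "j + 2 \<le> i" using less.prems by presburger
    have a2: "adjacent A y (x (i - 2))" using out_minus_2[OF y, of i] less.prems j2 by simp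
    show ?thesis
    proof (cases "(y, x (i - 2)) \<in> A")
      case True
      then show ?thesis using less.IH[of "i - 2"] less.prems j2 by simp
    next
      case False
      then have in2: "(x (i - 2), y) \<in> A" using a2 by (simp add: adjacent_def)
      show ?thesis
      proof (cases "j = i - 2")
        case True then show ?thesis using a2 by simp
      next
        case False
        then have j4: "j + 4 \<le> i" using less.prems j2 by presburger
        have a4: "adjacent A y (x (i - 4))" using out_minus_4[OF y, of i] less.prems j4 by simp
        moreover have "(x (i - 4), y) \<notin> A"
        proof
          assume "(x (i - 4), y) \<in> A"
          then have "i \<le> i - 4 + 2" using gap[of i "i - 4" y] less.prems j4 by simp
          then show False using j4 by simp
        qed
        ultimately have "(y, x (i - 4)) \<in> A" by (simp add: adjacent_def)
        then show ?thesis using less.IH[of "i - 4"] less.prems j4 by simp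
      qed
    qed
  qed
qed

lemma dual_adjacent: "adjacent (A\<inverse>) a b = adjacent A a b"
  by (auto simp: adjacent_def)

lemma in_wrap:
  assumes y: "y \<notin> P" and i: "k - 2 < i" "i \<le> k + 2" "(x i, y) \<in> A"
  shows "adjacent A y (x (i + 1 - k))"
proof -
  have "k + 2 - (k + 2 - i + k - 1) = i + 1 - k" using i k5 by linarith
  then show ?thesis
    using long_geodesic.out_wrap[OF dual, of y "k + 2 - i"] y i k5
    by (simp add: dual_P[simplified] dual_adjacent del: One_nat_def)
qed

lemma in_up:
  assumes y: "y \<notin> P" and i: "i \<le> j" "j \<le> k + 2" "(x i, y) \<in> A" "even (i + j)"
  shows "adjacent A y (x j)"
  using long_geodesic.out_down[OF dual, of y "k + 2 - i" "k + 2 - j"] y i k5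
  by (simp add: dual_P[simplified] dual_adjacent)

text \<open>These four indices are the part of a class to which a vertex of that type must be adjacent.\<close>

lemma corner_out:
  assumes y: "y \<notin> P" and i: "i \<le> k + 2" "(y, x i) \<in> A" "even (i + p)" "p \<le> 1"
  shows "adjacent A y (x p) \<and> adjacent A y (x (p + 2)) \<and>
    adjacent A y (x (k - 1 + p)) \<and> adjacent A y (x (k + 1 + p))"
proof -
  have evk: "even (k - 1)" "even (k + 1)" using odd_k by auto
  have up: "adjacent A y (x (p + b))" if "(x (p + a), y) \<in> A" "a \<le> b" "b \<le> k + 1" "even a" "even b" for a b
    using in_up[OF y, of "p + a" "p + b"] that i by simp
  have down: "adjacent A y (x (p + a))" if "(y, x (p + b)) \<in> A" "a \<le> b" "b \<le> k + 1" "even a" "even b" for a b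
    using out_down[OF y, of "p + b" "p + a"] that i by simp
  have 0: "adjacent A y (x (p + 0))"
  proof -
    have "p \<le> i" using i by presburger
    then show ?thesis using out_down[OF y, of i p] i by simp
  qed
  have 1: "adjacent A y (x (p + (k - 1)))"
    using 0 up[of 0 "k - 1"] out_wrap[OF y, of p] i evk k5 by (auto simp: adjacent_def)
  \<comment> \<open>An out-arc to index \<open>p + (k - 1)\<close> descends to \<open>p + 2\<close>.
    An in-arc from it gives adjacency at \<open>p + (k + 1)\<close>, from where one descends or
    wraps around.\<close>
  have 2: "adjacent A y (x (p + 2))"
  proof (cases "(y, x (p + (k - 1))) \<in> A")
    case True
    then show ?thesis using down[of "k - 1" 2] evk k5 by simp
  next
    case False
    then have "(x (p + (k - 1)), y) \<in> A" using 1 by (simp add: adjacent_def)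
    then have "adjacent A y (x (p + (k + 1)))" using up[of "k - 1" "k + 1"] evk by simp
    then consider "(y, x (p + (k + 1))) \<in> A" | "(x (p + (k + 1)), y) \<in> A"
      by (auto simp: adjacent_def)
    then show ?thesis
    proof cases
      case 1
      then show ?thesis using down[of "k + 1" 2] evk k5 by simp
    next
      case 2
      have "p + (k + 1) + 1 - k = p + 2" by simp
      then show ?thesis using in_wrap[OF y, of "p + (k + 1)"] 2 i k5 by simp
    qed
  qed
  have 3: "adjacent A y (x (p + (k + 1)))"
  proof (cases "(y, x (p + 2)) \<in> A")
    case True
    have "p + 2 + k - 1 = p + (k + 1)" by simp
    then show ?thesis using out_wrap[OF y, of "p + 2"] True i by simp
  next
    case False
    then show ?thesis using 2 up[of 2 "k + 1"] evk k5 by (auto simp: adjacent_def)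
  qed
  show ?thesis using 0 1 2 3 by (simp add: add.commute)
qed

lemma corners:
  assumes y: "y \<notin> P" and p: "parity_type p y" "p \<le> 1"
  shows "adjacent A y (x p) \<and> adjacent A y (x (p + 2)) \<and>
    adjacent A y (x (k - 1 + p)) \<and> adjacent A y (x (k + 1 + p))"
proof -
  obtain i where i: "i \<le> k + 2" "even (i + p)" "adjacent A y (x i)" using p by (auto simp: parity_type_def)
  show ?thesis
  proof (cases "(y, x i) \<in> A")
    case True
    then show ?thesis using corner_out[OF y] i p by blast
  next
    case False
    then have "(y, x i) \<in> A\<inverse>" using i by (simp add: adjacent_def)
    \<comment> \<open>Reversal carries the four indices of class \<open>1 - p\<close> to those of
      class \<open>p\<close>.\<close>
    moreover have "k + 2 - (1 - p) = k + 1 + p" "k + 2 - (1 - p + 2) = k - 1 + p"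
      "k + 2 - (k - 1 + (1 - p)) = p + 2" "k + 2 - (k + 1 + (1 - p)) = p" "k + 2 - (k + 2 - i) = i"
      using p k5 i by linarith+
    moreover have "even (k + 2 - i + (1 - p))" using i p odd_k by auto
    ultimately show ?thesis
      using long_geodesic.corner_out[OF dual, of y "k + 2 - i" "1 - p"] y
      by (simp only: dual_P dual_adjacent) auto
  qed
qed

text \<open>\<open>k + 1 + p\<close> is the largest index of the class and belongs to
  \<open>corners\<close>; the arc there must leave \<open>y\<close>, and \<open>out_down\<close>
  reaches the rest.\<close>

lemma all_out:
  assumes y: "y \<notin> P" and p: "parity_type p y" "p \<le> 1"
    and no_in: "\<And>i. i \<le> k + 2 \<Longrightarrow> even (i + p) \<Longrightarrow> (x i, y) \<notin> A"
    and i: "i \<le> k + 2" "even (i + p)"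
  shows "(y, x i) \<in> A"
proof -
  have "(y, x (k + 1 + p)) \<in> A"
    using corners[OF y p] no_in[of "k + 1 + p"] odd_k p by (auto simp: adjacent_def)
  moreover have "i \<le> k + 1 + p"
  proof (rule ccontr)
    assume "\<not> i \<le> k + 1 + p"
    then have "i = k + 2" "p = 0" using i by auto
    then show False using i odd_k by auto
  qed
  moreover have "even (k + 1 + p + i)" using i odd_k by auto
  ultimately have "adjacent A y (x i)" using out_down[OF y, of "k + 1 + p" i] p by simp
  then show ?thesis using no_in i by (auto simp: adjacent_def)
qed

lemma all_in:
  assumes y: "y \<notin> P" and p: "parity_type p y" "p \<le> 1"
    and no_out: "\<And>i. i \<le> k + 2 \<Longrightarrow> even (i + p) \<Longrightarrow> (y, x i) \<notin> A"
    and i: "i \<le> k + 2" "even (i + p)"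
  shows "(x i, y) \<in> A"
proof -
  have "(x p, y) \<in> A"
    using corners[OF y p] no_out[of p] p by (auto simp: adjacent_def)
  moreover have "p \<le> i" using i p by (cases i) (auto simp: le_Suc_eq)
  ultimately have "adjacent A y (x i)" using in_up[OF y, of p i] i by (simp add: add.commute)
  then show ?thesis using no_out i by (auto simp: adjacent_def)
qed

section \<open>Adjacency of two outside vertices through \<open>P\<close>\<close>

text \<open>The way round the cycle from \<open>x i\<close> to \<open>x (i - 3)\<close> is two arcs
  too long, and a chord skips two vertices.\<close>

lemma out_minus_3_in:
  assumes "z \<notin> P" "w \<notin> P" "z \<noteq> w"
    and i: "3 \<le> i" "i \<le> k + 2" "(z, x i) \<in> A" "(x (i - 3), w) \<in> A"
  shows "adjacent A z w"
proof -
  note o = outside[OF assms(1)] outside[OF assms(2)]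
  consider "i \<le> k" | "i = k + 1" | "i = k + 2" using i by linarith
  then show ?thesis
  proof cases
    case 1
    then show ?thesis using assms k5
      by (intro kpath_adj[of "z # seg i k @ seg 0 (i - 3) @ [w]"])
        (auto simp add: seg_simps o chords)
  next
    case 2
    then show ?thesis using assms k5
      by (intro kpath_adj[of "z # x (k + 1) # seg 1 (k - 2) @ [w]"])
        (auto simp add: seg_simps o chords)
  next
    case 3
    then show ?thesis using assms k5
      by (intro kpath_adj[of "z # x (k + 2) # seg 2 (k - 1) @ [w]"])
        (auto simp add: seg_simps o chords)
  qed
qed

lemma out_plus_in:
  assumes "z \<notin> P" "w \<notin> P" "z \<noteq> w"
    and i: "i \<le> 4" "(z, x i) \<in> A" "(x (i + k - 2), w) \<in> A"
  shows "adjacent A z w"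
proof -
  note o = outside[OF assms(1)] outside[OF assms(2)]
  show ?thesis using assms k5
      by (intro kpath_adj[of "z # seg i (i + k - 2) @ [w]"])
        (auto simp add: seg_simps o chords)
qed

text \<open>\<open>z\<close> may enter \<open>P\<close> wherever a path of length \<open>k\<close>
  to \<open>w\<close> requires: at \<open>b + 3\<close> or, past the end of \<open>P\<close>, at
  \<open>b + 2 - k\<close>. Both have parity opposite to \<open>b\<close>.\<close>

lemma all_out_some_in_adj:
  assumes zw: "z \<notin> P" "w \<notin> P" "z \<noteq> w"
    and out: "\<And>i. i \<le> k + 2 \<Longrightarrow> even (i + p) \<Longrightarrow> (z, x i) \<in> A"
    and b: "b \<le> k + 2" "odd (b + p)" "(x b, w) \<in> A"
  shows "adjacent A z w"
proof (cases "b + 3 \<le> k + 2")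
  case True
  then show ?thesis using out_minus_3_in[OF zw, of "b + 3"] out[of "b + 3"] b by auto
next
  case False
  then have "even (b + 2 - k + p)" "b + 2 - k + k - 2 = b" "b + 2 - k \<le> 4" using b odd_k k5 by auto
  then show ?thesis using out_plus_in[OF zw, of "b + 2 - k"] out[of "b + 2 - k"] b k5 by simp
qed

lemma all_in_some_out_adj:
  assumes zw: "z \<notin> P" "w \<notin> P" "z \<noteq> w"
    and inn: "\<And>i. i \<le> k + 2 \<Longrightarrow> even (i + p) \<Longrightarrow> (x i, z) \<in> A"
    and b: "b \<le> k + 2" "odd (b + p)" "(w, x b) \<in> A"
  shows "adjacent A z w"
proof -
  have "(z, x (k + 2 - i)) \<in> A\<inverse>" if "i \<le> k + 2" "even (i + Suc p)" for i
    using inn[of "k + 2 - i"] that odd_k by auto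
  moreover have "odd (k + 2 - b + Suc p)" using b odd_k by auto
  ultimately show ?thesis
    using long_geodesic.all_out_some_in_adj[OF dual, of z w "Suc p" "k + 2 - b"] zw b
    by (simp add: dual_P[simplified] dual_adjacent)
qed

text \<open>If \<open>z\<close> and \<open>w\<close> are not adjacent, \<open>d1\<close> to
  \<open>d5\<close> exclude pairs of arcs that a segment of the cycle would join to a path of length
  \<open>k\<close>. With the bounds \<open>zz\<close> and \<open>ww\<close> from \<open>gap\<close>,
  they orient the arcs at the corners until two conflict.\<close>

lemma mixed_adj:
  assumes zw: "z \<notin> P" "w \<notin> P" "z \<noteq> w"
    and z: "i \<le> k + 2" "even i" "(z, x i) \<in> A" "i' \<le> k + 2" "even i'" "(x i', z) \<in> A"
    and w: "j \<le> k + 2" "odd j" "(w, x j) \<in> A" "j' \<le> k + 2" "odd j'" "(x j', w) \<in> A"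
  shows "adjacent A z w"
proof (rule ccontr)
  assume na: "\<not> adjacent A z w"
  then have na': "\<not> adjacent A w z" using adj_sym by blast
  have wz: "w \<noteq> z" using zw by auto
  have types: "parity_type 0 z" "parity_type 1 w" using z w by (auto simp: parity_type_def adjacent_def)
  note cz = corners[OF zw(1) types(1), simplified] and cw = corners[OF zw(2) types(2), simplified]
  have zz: "a \<le> b + 2" if "a \<le> k + 2" "b \<le> k + 2" "(z, x a) \<in> A" "(x b, z) \<in> A" for a b
    using gap that by blast
  have ww: "a \<le> b + 2" if "a \<le> k + 2" "b \<le> k + 2" "(w, x a) \<in> A" "(x b, w) \<in> A" for a b
    using gap that by blast
  have d1: "(z, x 2) \<notin> A \<or> (x k, w) \<notin> A"
    using out_plus_in[OF zw, of 2] na by auto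
  have d2: "(z, x 4) \<notin> A \<or> (x (k + 2), w) \<notin> A"
    using out_plus_in[OF zw, of 4] na by auto
  have d3: "(w, x 1) \<notin> A \<or> (x (k - 1), z) \<notin> A"
    using out_plus_in[OF zw(2,1) wz, of 1] na' k5 by auto
  have d4: "(w, x 3) \<notin> A \<or> (x (k + 1), z) \<notin> A"
    using out_plus_in[OF zw(2,1) wz, of 3] na' by auto
  have d5: "(w, x 5) \<notin> A \<or> (x 2, z) \<notin> A"
    using out_minus_3_in[OF zw(2,1) wz, of 5] na' k5 by auto
  have az: "(z, x 2) \<in> A \<or> (x 2, z) \<in> A" "(z, x (k - 1)) \<in> A \<or> (x (k - 1), z) \<in> A"
    "(z, x (k + 1)) \<in> A \<or> (x (k + 1), z) \<in> A"
    using cz by (simp_all add: adjacent_def numeral_2_eq_2)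
  have aw: "(w, x 1) \<in> A \<or> (x 1, w) \<in> A" "(w, x 3) \<in> A \<or> (x 3, w) \<in> A"
    "(w, x k) \<in> A \<or> (x k, w) \<in> A" "(w, x (k + 2)) \<in> A \<or> (x (k + 2), w) \<in> A"
    using cw k5 by (simp_all add: adjacent_def numeral_3_eq_3)
  \<comment> \<open>For \<open>k = 5\<close> the bounds of \<open>gap\<close> are just met in the
    two uses below; \<open>d2\<close> then gives the contradiction.\<close>
  have five: False if "k = 5" "(x 3, w) \<in> A" "(z, x (k - 1)) \<in> A"
  proof -
    have "(w, x (k + 2)) \<in> A" using that d2 aw(4) by auto
    then show False using ww[of "k + 2" 3] that by simp
  qed
  show False
  proof (cases "(z, x 2) \<in> A")
    case True
    then have wk: "(w, x k) \<in> A" using d1 aw by auto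
    then have "(x 1, w) \<notin> A" using ww[of k 1] k5 by auto
    then have zk: "(z, x (k - 1)) \<in> A" using aw d3 az by auto
    show False
    proof (cases "(w, x 3) \<in> A")
      case True
      then have "(z, x (k + 1)) \<in> A" using d4 az by auto
      then have "k + 1 \<le> i' + 2" using zz[of "k + 1" i'] z by auto
      then have "i' = k - 1 \<or> i' = k + 1" using z odd_k by presburger
      then show False using z d3 d4 True \<open>(x 1, w) \<notin> A\<close> aw by auto
    next
      case False
      then have x3: "(x 3, w) \<in> A" using aw by auto
      then have "k \<le> 5" using ww[of k 3] wk k5 by simp
      then have "k = 5" using k5 by simp
      then show False using five x3 zk by blast
    qed
  next
    case False
    then have z2: "(x 2, z) \<in> A" using az by auto
    have w3: "(w, x 3) \<notin> A"
    proof
      assume "(w, x 3) \<in> A"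
      then have "(z, x (k + 1)) \<in> A" using d4 az by auto
      then show False using zz[of "k + 1" 2] z2 k5 by auto
    qed
    then have "j \<le> 5" using ww[of j 3] w aw k5 by auto
    then have "j = 1 \<or> j = 3 \<or> j = 5" using w(2) by presburger
    then have "j = 1" using w w3 d5 z2 by auto
    then have zk: "(z, x (k - 1)) \<in> A" using w d3 az by auto
    then have "k - 1 \<le> 4" using zz[of "k - 1" 2] z2 by simp
    then have "k = 5" using k5 by simp
    then show False using five w3 aw zk by blast
  qed
qed


section \<open>Changing the parity by an opposite pair\<close>

text \<open>The next two lemmas leave the geodesic through \<open>y\<close> exactly once; entering and leaving
  \<open>y\<close> at indices of opposite parity is what changes the parity of the end point.\<close>

lemma out_detour:
  assumes wy: "w \<notin> P" "y \<notin> P" "w \<noteq> y"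
    and arcs: "(w, x a) \<in> A" "(x j, y) \<in> A" "(y, x i) \<in> A"
    and ineq: "a \<le> j" "i \<le> b" "b < a" "j \<le> k + 2" "j - a + (b - i) + 3 = k" and "odd b"
  shows "parity_type 1 w"
proof -
  note o = outside[OF wy(1)] outside[OF wy(2)]
  have "adjacent A w (x b)"
    using arcs ineq wy
    by (intro kpath_adj[of "w # seg a j @ y # seg i b"]) (simp_all add: seg_simps o chords)
  moreover have "b \<le> k + 2" using ineq by linarith
  ultimately show ?thesis using \<open>odd b\<close> unfolding parity_type_def by (intro exI[of _ b]) simp
qed

lemma in_detour:
  assumes wy: "w \<notin> P" "y \<notin> P" "w \<noteq> y"
    and arcs: "(x e, w) \<in> A" "(x j, y) \<in> A" "(y, x i) \<in> A"
    and ineq: "b \<le> j" "i \<le> e" "e < b" "j \<le> k + 2" "j - b + (e - i) + 3 = k" and "odd b"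
  shows "parity_type 1 w"
proof -
  note o = outside[OF wy(1)] outside[OF wy(2)]
  have "adjacent A (x b) w"
    using arcs ineq wy
    by (intro kpath_adj[of "seg b j @ y # seg i e @ [w]"]) (auto simp add: seg_simps o chords)
  then have "adjacent A w (x b)" by (rule adj_sym)
  moreover have "b \<le> k + 2" using ineq by linarith
  ultimately show ?thesis using \<open>odd b\<close> unfolding parity_type_def by (intro exI[of _ b]) simp
qed

text \<open>\<open>y\<close> has both types, so all eight corners are adjacent to it. The case split
  orients these arcs until a detour through \<open>y\<close> of the right length is available; the
  direction of an arc between \<open>w\<close> and one of its corners decides between
  \<open>OD\<close> and \<open>ID\<close>.\<close>

lemma odd_type_of_opposite_pair:
  assumes wy: "w \<notin> P" "y \<notin> P" "w \<noteq> y" and w: "parity_type 0 w"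
    and y: "i \<le> k + 2" "j \<le> k + 2" "odd (i + j)" "(y, x i) \<in> A" "(x j, y) \<in> A"
  shows "parity_type 1 w"
proof -
  note OD = out_detour[OF wy] and ID = in_detour[OF wy]
  have types: "parity_type 0 y" "parity_type 1 y"
    using y unfolding parity_type_def adjacent_def by (cases "even i"; force)+
  have ay: "(y, x 0) \<in> A \<or> (x 0, y) \<in> A" "(y, x 1) \<in> A \<or> (x 1, y) \<in> A"
    "(y, x 2) \<in> A \<or> (x 2, y) \<in> A" "(y, x 3) \<in> A \<or> (x 3, y) \<in> A"
    "(y, x (k - 1)) \<in> A \<or> (x (k - 1), y) \<in> A" "(y, x k) \<in> A \<or> (x k, y) \<in> A"
    "(y, x (k + 1)) \<in> A \<or> (x (k + 1), y) \<in> A" "(y, x (k + 2)) \<in> A \<or> (x (k + 2), y) \<in> A"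
    using corners[OF wy(2) types(1)] corners[OF wy(2) types(2)] k5
    by (simp_all add: adjacent_def numeral_2_eq_2 numeral_3_eq_3)
  have aw: "(w, x 2) \<in> A \<or> (x 2, w) \<in> A" "(w, x (k - 1)) \<in> A \<or> (x (k - 1), w) \<in> A"
    "(w, x (k + 1)) \<in> A \<or> (x (k + 1), w) \<in> A"
    using corners[OF wy(1) w] by (simp_all add: adjacent_def numeral_2_eq_2)
  have g: "a \<le> b + 2" if "(y, x a) \<in> A" "(x b, y) \<in> A" "a \<le> k + 2" "b \<le> k + 2" for a b
    using gap that by blast
  \<comment> \<open>Either direction of the arc between \<open>w\<close> and
    \<open>x (k - 1)\<close> allows a detour, making \<open>w\<close> adjacent to
    \<open>x (k - 2)\<close> or \<open>x k\<close>.\<close>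
  have out3: "parity_type 1 w" if "(y, x 3) \<in> A" "(x (k + 1), y) \<in> A"
    using aw(2) OD[of "k - 1" "k + 1" 3 "k - 2"] ID[of "k - 1" "k + 1" 3 k] that k5 odd_k by auto
  show ?thesis
  proof (cases "(y, x 2) \<in> A")
    case False
    then have in2: "(x 2, y) \<in> A" using ay by simp
    have le4: "a \<le> 4" if "(y, x a) \<in> A" "a \<le> k + 2" for a
      using g[of a 2] in2 that by simp
    have hi: "(x k, y) \<in> A" "(x (k + 1), y) \<in> A"
      using ay le4[of k] le4[of "k + 1"] k5 by auto
    show ?thesis
    proof (cases "(y, x 3) \<in> A")
      case True
      then show ?thesis using out3 hi by simp
    next
      case False
      then have in3: "(x 3, y) \<in> A" using ay by simp
      have "adjacent A y (x (k - 2))" using in_up[OF wy(2), of 3 "k - 2"] in3 k5 odd_k by simp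
      moreover have "(y, x (k - 2)) \<notin> A"
      proof
        assume *: "(y, x (k - 2)) \<in> A"
        then have "k - 2 \<le> 4" using le4[of "k - 2"] by simp
        then have "k - 2 = 3" using k5 odd_k by presburger
        then show False using * False by simp
      qed
      ultimately have ink2: "(x (k - 2), y) \<in> A" by (simp add: adjacent_def)
      show ?thesis
      proof (cases "(y, x 0) \<in> A")
        case True
        then show ?thesis
          using aw(1) OD[of 2 "k - 2" 0 1] ID[of 2 k 0 5] hi ink2 k5 by auto
      next
        case no0: False
        then have le2: "a \<le> 2" if "(y, x a) \<in> A" "a \<le> k + 2" for a
          using g[of a 0] ay(1) that by simp
        \<comment> \<open>The given out-neighbour must be \<open>x 1\<close>, since 0 and 2 are
          excluded.\<close>
        then have "i \<le> 2" using y by simp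
        then have "i = 1" using y no0 \<open>(y, x 2) \<notin> A\<close> by (cases "i = 0"; cases "i = 2"; simp)
        then have "(y, x 1) \<in> A" using y by simp
        moreover have "(y, x (k - 1)) \<notin> A"
        proof
          assume "(y, x (k - 1)) \<in> A"
          then have "k - 1 \<le> 2" using le2[of "k - 1"] by simp
          then show False using k5 by simp
        qed
        then have "(x (k - 1), y) \<in> A" using ay(5) by simp
        ultimately show ?thesis
          using aw(1) OD[of 2 "k - 1" 1 1] ID[of 2 "k - 1" 1 3] k5 by auto
      qed
    qed
  next
    case out2: True
    show ?thesis
    proof (cases "(x k, y) \<in> A")
      case True
      then show ?thesis
        using aw(2) OD[of "k - 1" k 2 "k - 2"] ID[of "k - 1" k 2 k] out2 k5 odd_k by auto
    next
      case nk: False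
      then have outk: "(y, x k) \<in> A" using ay by simp
      then have ge: "k \<le> b + 2" if "(x b, y) \<in> A" "b \<le> k + 2" for b
        using g[of k b] that by simp
      have out01: "(y, x 0) \<in> A" "(y, x 1) \<in> A" using ay ge[of 0] ge[of 1] k5 by auto
      show ?thesis
      proof (cases "(x (k + 1), y) \<in> A")
        case True
        show ?thesis
        proof (cases "(y, x 3) \<in> A")
          case True
          then show ?thesis using out3 \<open>(x (k + 1), y) \<in> A\<close> by simp
        next
          case False
          then have in3: "(x 3, y) \<in> A" using ay by simp
          then have k: "k = 5" using ge[of 3] k5 by simp
          moreover have "(x 7, y) \<in> A" using ay(8) g[of 7 3] in3 k by auto
          ultimately show ?thesis
            using aw(2) OD[of 4 6 1 1] ID[of 4 7 2 7] True out01 out2 by auto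
        qed
      next
        case nk1: False
        then have outk1: "(y, x (k + 1)) \<in> A" using ay by simp
        then have ge1: "k + 1 \<le> b + 2" if "(x b, y) \<in> A" "b \<le> k + 2" for b
          using g[of "k + 1" b] that by simp
        \<comment> \<open>Otherwise the out-arc to \<open>x (k + 2)\<close> forces \<open>j\<close>
          to be at least \<open>k\<close>, and all three values are excluded.\<close>
        have ink2: "(x (k + 2), y) \<in> A"
        proof (rule ccontr)
          assume no: "(x (k + 2), y) \<notin> A"
          then have "k + 2 \<le> j + 2" using ay g[of "k + 2" j] y by auto
          then have "j = k \<or> j = k + 1 \<or> j = k + 2" using y by linarith
          then show False using no nk nk1 y by auto
        qed
        show ?thesis
        proof (cases "(x (k - 1), y) \<in> A")
          case True
          then show ?thesis
            using aw(2) OD[of "k - 1" "k - 1" 1 "k - 2"] ID[of "k - 1" "k + 2" 2 "k + 2"]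
              ink2 out01 out2 k5 odd_k by auto
        next
          case False
          have "adjacent A y (x 4)" using out_down[OF wy(2), of "k + 1" 4] outk1 odd_k k5 by simp
          moreover have "(x 4, y) \<notin> A"
          proof
            assume *: "(x 4, y) \<in> A"
            then have "k - 1 = 4" using ge1[of 4] k5 by simp
            then show False using * False by simp
          qed
          ultimately have "(y, x 4) \<in> A" by (simp add: adjacent_def)
          then show ?thesis
            using aw(3) OD[of "k + 1" "k + 2" 0 "k - 4"] ID[of "k + 1" "k + 2" 4 "k + 2"]
              ink2 out01 k5 odd_k by auto
        qed
      qed
    qed
  qed
qed

lemma both_types_of_opposite_pair:
  assumes wy: "w \<notin> P" "y \<notin> P" and w: "parity_type p w"
    and y: "i \<le> k + 2" "j \<le> k + 2" "odd (i + j)" "(y, x i) \<in> A" "(x j, y) \<in> A"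
  shows "parity_type q w"
proof -
  have "parity_type 0 w \<and> parity_type 1 w"
  proof (cases "w = y")
    case True
    then show ?thesis
      using y unfolding parity_type_def adjacent_def by (cases "even i"; force)
  next
    case False
    show ?thesis
    proof (cases "even p")
      case True
      then have "parity_type 0 w" using parity_type_cong[of p 0] w by simp
      then show ?thesis using odd_type_of_opposite_pair[OF wy False _ y] by simp
    next
      case odd: False
      then have 1: "parity_type 1 w" using parity_type_cong[of p 1] w by simp
      have "odd (k + 2 - j + (k + 2 - i))" using y by presburger
      \<comment> \<open>Type 1 is type 0 of the reversed digraph; its type 1 is class 2 here, that
        is, type 0.\<close>
      then have "parity_type 2 w" using 1
        long_geodesic.odd_type_of_opposite_pair[OF dual, of w y "k + 2 - j" "k + 2 - i"] wy False y
        unfolding dual_P dual_parity_type by (simp add: numeral_2_eq_2)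
      then show ?thesis using 1 parity_type_cong[of 2 0] by simp
    qed
  qed
  then show ?thesis using parity_type_cong[of q 0] parity_type_cong[of q 1] by (cases "even q") auto
qed


subsection \<open>Distance to the geodesic\<close>

definition dist_to_P :: "'a \<Rightarrow> nat" where
  "dist_to_P y = (LEAST n. \<exists>i\<le>k + 2. (y, x i) \<in> A ^^ n)"

lemma dist_to_P_le: "(y, x i) \<in> A ^^ n \<Longrightarrow> i \<le> k + 2 \<Longrightarrow> dist_to_P y \<le> n"
  unfolding dist_to_P_def by (rule Least_le) auto

lemma dist_to_P_reach:
  assumes "y \<in> V"
  obtains i where "i \<le> k + 2" "(y, x i) \<in> A ^^ dist_to_P y"
proof -
  obtain n where "(y, x 0) \<in> A ^^ n"
    using strongly[OF assms x_V[of 0]] rtrancl_imp_relpow by fastforce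
  then have "\<exists>i\<le>k + 2. (y, x i) \<in> A ^^ n" by (intro exI[of _ 0]) simp
  then have "\<exists>i\<le>k + 2. (y, x i) \<in> A ^^ dist_to_P y" unfolding dist_to_P_def by (rule LeastI)
  then show thesis using that by auto
qed

lemma dist_to_P_walk:
  assumes "b \<in> V" "(a, b) \<in> A ^^ n"
  shows "dist_to_P a \<le> n + dist_to_P b"
proof -
  obtain i where i: "i \<le> k + 2" "(b, x i) \<in> A ^^ dist_to_P b" using dist_to_P_reach assms by blast
  then have "(a, x i) \<in> A ^^ (n + dist_to_P b)" using assms relpow_trans by fast
  then show ?thesis using dist_to_P_le i by blast
qed

lemma dist_to_P_arc: "(a, b) \<in> A \<Longrightarrow> dist_to_P a \<le> Suc (dist_to_P b)"
  using dist_to_P_walk[of b a 1] arcs_V by auto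

lemma dist_to_P_0: "y \<in> V \<Longrightarrow> dist_to_P y = 0 \<longleftrightarrow> y \<in> P"
proof
  assume "y \<in> V" "dist_to_P y = 0"
  then show "y \<in> P" using dist_to_P_reach[of y] by auto
next
  assume "y \<in> P"
  then obtain i where "i \<le> k + 2" "y = x i" by auto
  then show "dist_to_P y = 0" using dist_to_P_le[of y i 0] by simp
qed

lemma dist_to_P_1: "(y, x i) \<in> A \<Longrightarrow> i \<le> k + 2 \<Longrightarrow> dist_to_P y \<le> 1"
  using dist_to_P_le[of y i 1] by simp

text \<open>A shortest walk to \<open>P\<close> comes closer by exactly one per arc, so its vertices
  are distinct and only the last lies on \<open>P\<close>.\<close>

lemma path_to_P:
  assumes y: "y \<in> W"
  obtains w c where "w 0 = y" "c \<le> k + 2" "w (dist_to_P y) = x c" "0 < dist_to_P y"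
    "\<And>i. i < dist_to_P y \<Longrightarrow> (w i, w (Suc i)) \<in> A"
    "\<And>i. i \<le> dist_to_P y \<Longrightarrow> dist_to_P (w i) = dist_to_P y - i"
    "\<And>i. i < dist_to_P y \<Longrightarrow> w i \<in> W"
    "\<And>i j. j \<le> dist_to_P y \<Longrightarrow> dipath (map w [i..<j])"
    "\<And>i j. j \<le> dist_to_P y \<Longrightarrow> w ` {i..<j} \<inter> P = {}"
proof -
  obtain c where c: "c \<le> k + 2" "(y, x c) \<in> A ^^ dist_to_P y" using dist_to_P_reach y by blast
  then obtain w where w: "w 0 = y" "w (dist_to_P y) = x c" "\<And>i. i < dist_to_P y \<Longrightarrow> (w i, w (Suc i)) \<in> A"
    unfolding relpow_fun_conv by auto
  have walk: "(w i, w j) \<in> A ^^ (j - i)" if "i \<le> j" "j \<le> dist_to_P y" for i j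
    unfolding relpow_fun_conv using w that by (intro exI[of _ "\<lambda>t. w (i + t)"]) auto
  have wV: "w i \<in> V" if "i \<le> dist_to_P y" for i
    using w(2) w(3)[of i] arcs_V c x_V that by (cases "i = dist_to_P y") auto
  have d: "dist_to_P (w i) = dist_to_P y - i" if "i \<le> dist_to_P y" for i
  proof -
    have "dist_to_P (w i) \<le> dist_to_P y - i" using dist_to_P_le[of "w i" c] walk[of i "dist_to_P y"] w that c by simp
    moreover have "dist_to_P y \<le> i + dist_to_P (w i)" using dist_to_P_walk[of "w i" y i] walk[of 0 i] w wV that by simp
    ultimately show ?thesis by simp
  qed
  have W: "w i \<in> W" if "i < dist_to_P y" for i
    using d[of i] wV[of i] dist_to_P_0[of "w i"] that by auto
  have inj: "i = j" if "i \<le> dist_to_P y" "j \<le> dist_to_P y" "w i = w j" for i j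
    using d[of i] d[of j] that by simp
  show thesis
  proof (rule that[of w c])
    show "0 < dist_to_P y" using dist_to_P_0[of y] y by auto
    show "dipath (map w [i..<j])" if "j \<le> dist_to_P y" for i j
      using that w(3) inj
      by (simp add: distinct_map successively_map successively_conv_nth inj_on_def)
    show "w ` {i..<j} \<inter> P = {}" if "j \<le> dist_to_P y" for i j
    proof -
      have "w t \<notin> P" if "t \<in> {i..<j}" for t using W[of t] that \<open>j \<le> dist_to_P y\<close> by auto
      then show ?thesis by blast
    qed
  qed (use w c d W in auto)
qed

text \<open>A short path to \<open>P\<close> is prolonged along the cycle. On a long one, the arc
  between \<open>y\<close> and \<open>w k\<close> must lead back to \<open>y\<close>. By induction
  \<open>w 2\<close> has a neighbour on \<open>P\<close>, and being too far away to send an arc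
  there it receives one. The path from \<open>w 2\<close> to \<open>w k\<close> and on to
  \<open>y\<close> then has \<open>k\<close> vertices and suits \<open>in_type\<close>.\<close>

lemma parity_type_exists: "y \<in> W \<Longrightarrow> \<exists>p. parity_type p y"
proof (induction "dist_to_P y" arbitrary: y rule: less_induct)
  case less
  obtain w c where w: "w 0 = y" "c \<le> k + 2" "w (dist_to_P y) = x c" "0 < dist_to_P y"
    "\<And>i. i < dist_to_P y \<Longrightarrow> (w i, w (Suc i)) \<in> A"
    "\<And>i. i \<le> dist_to_P y \<Longrightarrow> dist_to_P (w i) = dist_to_P y - i"
    "\<And>i. i < dist_to_P y \<Longrightarrow> w i \<in> W"
    "\<And>i j. j \<le> dist_to_P y \<Longrightarrow> dipath (map w [i..<j])"
    "\<And>i j. j \<le> dist_to_P y \<Longrightarrow> w ` {i..<j} \<inter> P = {}"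
    using path_to_P[OF less.prems] by blast
  show ?case
  proof (cases "dist_to_P y \<le> k")
    case True
    have "parity_type (c + k + length (map w [0..<dist_to_P y])) (hd (map w [0..<dist_to_P y]))"
      using w True w(5)[of "dist_to_P y - 1"] w(8)[of "dist_to_P y" 0] w(9)[of "dist_to_P y" 0]
      by (intro out_type) (auto simp: last_map)
    then show ?thesis using w by (auto simp: hd_map)
  next
    case False
    have "adjacent A y (w k)"
      using w(1,4) w(8)[of "Suc k" 0] False
      by (intro kpath_adj[of "map w [0..<Suc k]"]) (auto simp: hd_map last_map simp del: upt_Suc)
    moreover have "(y, w k) \<notin> A" using dist_to_P_arc[of y "w k"] w(6)[of k] False k5 by auto
    ultimately have ky: "(w k, y) \<in> A" by (simp add: adjacent_def)
    obtain p where "parity_type p (w 2)" using less.hyps[of "w 2"] w(6,7)[of 2] False k5 by auto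
    then obtain e where e: "e \<le> k + 2" "adjacent A (w 2) (x e)" by (auto simp: parity_type_def)
    moreover have "(w 2, x e) \<notin> A" using dist_to_P_1[of "w 2" e] e w(6)[of 2] False k5 by auto
    ultimately have e2: "(x e, w 2) \<in> A" by (simp add: adjacent_def)
    have "y \<notin> w ` {2..<Suc k}"
    proof
      assume "y \<in> w ` {2..<Suc k}"
      then obtain i where "2 \<le> i" "i \<le> k" "y = w i" by auto
      then show False using w(6)[of i] False by simp
    qed
    then have "parity_type (e + k + length (map w [2..<Suc k] @ [y])) (last (map w [2..<Suc k] @ [y]))"
      using w(8)[of "Suc k" 2] w(9)[of "Suc k" 2] False k5 e e2 ky less.prems
      by (intro in_type) (auto simp: successively_append_iff hd_map last_map simp del: upt_Suc)
    then show ?thesis by auto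
  qed
qed

lemma parity_type_unique:
  assumes "\<And>y. y \<in> W \<Longrightarrow> \<not> (parity_type 0 y \<and> parity_type 1 y)" and "y \<in> W" "parity_type p y" "parity_type q y"
  shows "even (p + q)"
  using assms parity_type_cong[of p 0 y] parity_type_cong[of p 1 y] parity_type_cong[of q 0 y] parity_type_cong[of q 1 y]
  by (cases "even p"; cases "even q"; simp)

lemma parity_type_Suc:
  assumes "y \<in> W" "\<not> parity_type p y"
  shows "parity_type (Suc p) y"
proof -
  obtain q where q: "parity_type q y" using parity_type_exists assms by blast
  then have "odd (q + p)" using parity_type_cong[of q p y] assms by auto
  then show ?thesis using q parity_type_cong[of q "Suc p" y] by auto
qed

lemma alternating_types:
  assumes W: "\<And>j. j < m \<Longrightarrow> w j \<in> W"
    and step: "\<And>j q. Suc j < m \<Longrightarrow> q \<le> 1 \<Longrightarrow> parity_type q (w j) \<Longrightarrow> \<not> parity_type q (w (Suc j))"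
    and p: "parity_type p (w 0)"
  shows "j < m \<Longrightarrow> parity_type (p + j) (w j)"
proof (induction j)
  case 0
  then show ?case using p by simp
next
  case (Suc j)
  define q where "q = (p + j) mod 2"
  have q: "q \<le> 1" "even (q + (p + j))" unfolding q_def by auto
  have "parity_type q (w j)" using Suc parity_type_cong[OF q(2)] by simp
  then have "parity_type (Suc q) (w (Suc j))" using parity_type_Suc W[of "Suc j"] step[OF Suc.prems q(1)] Suc.prems by blast
  then show ?case using parity_type_cong[of "Suc q" "p + Suc j"] q by auto
qed

text \<open>Induction on the distance from \<open>y\<close> to \<open>P\<close>: if the distance is short, prolonging a shortest
  path by arcs of the cycle to length \<open>k\<close>, started from \<open>z\<close> and from \<open>y\<close>, yields opposite classes;
  otherwise the first \<open>k\<close> vertices of the shortest path together with \<open>z\<close> do.\<close>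

lemma arc_types:
  assumes B: "\<And>y. y \<in> W \<Longrightarrow> \<not> (parity_type 0 y \<and> parity_type 1 y)"
  shows "z \<in> W \<Longrightarrow> y \<in> W \<Longrightarrow> z \<noteq> y \<Longrightarrow> (z, y) \<in> A \<Longrightarrow> p \<le> 1 \<Longrightarrow> parity_type p z \<Longrightarrow> parity_type p y \<Longrightarrow> False"
proof (induction "dist_to_P y" arbitrary: z y p rule: less_induct)
  case less
  note U = parity_type_unique[OF B]
  obtain w c where w: "w 0 = y" "c \<le> k + 2" "w (dist_to_P y) = x c" "0 < dist_to_P y"
    "\<And>i. i < dist_to_P y \<Longrightarrow> (w i, w (Suc i)) \<in> A"
    "\<And>i. i \<le> dist_to_P y \<Longrightarrow> dist_to_P (w i) = dist_to_P y - i"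
    "\<And>i. i < dist_to_P y \<Longrightarrow> w i \<in> W"
    "\<And>i j. j \<le> dist_to_P y \<Longrightarrow> dipath (map w [i..<j])"
    "\<And>i j. j \<le> dist_to_P y \<Longrightarrow> w ` {i..<j} \<inter> P = {}"
    using path_to_P[OF less.prems(2)] by blast
  \<comment> \<open>An in-arc from \<open>P\<close> would give \<open>z\<close> and \<open>y\<close>
    opposite types.\<close>
  have no_in: "(x i, z) \<notin> A" if i: "i \<le> k + 2" for i
  proof
    assume a: "(x i, z) \<in> A"
    have "parity_type (i + k + length [z, y]) (last [z, y])"
      using less.prems i a k5 by (intro in_type) auto
    moreover have "parity_type (i + k + length [z]) (last [z])"
      using less.prems i a k5 by (intro in_type) auto
    ultimately show False using U[of y "i + k + 2" p] U[of z "i + k + 1" p] less.prems by auto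
  qed
  have out: "(z, x i) \<in> A" if "i \<le> k + 2" "even (i + p)" for i
    using all_out[of z p] less.prems no_in that by blast
  have kp: "k + 1 + p \<le> k + 2" "even (k + 1 + p + p)" using less.prems odd_k by auto
  have dz: "dist_to_P z = 1"
    using dist_to_P_1[of z "k + 1 + p"] out[OF kp] kp dist_to_P_0[of z] less.prems by fastforce
  have km: "k \<le> dist_to_P y"
  proof (rule ccontr)
    assume small: "\<not> k \<le> dist_to_P y"
    show False
    proof (cases "z \<in> w ` {0..<dist_to_P y}")
      case False
      have "parity_type (c + k + length (map w [0..<dist_to_P y])) (hd (map w [0..<dist_to_P y]))"
        using w small w(5)[of "dist_to_P y - 1"] w(8)[of "dist_to_P y" 0] w(9)[of "dist_to_P y" 0]
        by (intro out_type) (auto simp: last_map)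
      moreover have "parity_type (c + k + length (z # map w [0..<dist_to_P y])) (hd (z # map w [0..<dist_to_P y]))"
        using w small w(5)[of "dist_to_P y - 1"] w(8)[of "dist_to_P y" 0] w(9)[of "dist_to_P y" 0] False less.prems
        by (intro out_type) (auto simp: last_map hd_map successively_Cons)
      ultimately have "parity_type (c + k + dist_to_P y) y" "parity_type (Suc (c + k + dist_to_P y)) z"
        using w by (simp_all add: hd_map)
      then show False using U[of y "c + k + dist_to_P y" p] U[of z "Suc (c + k + dist_to_P y)" p] less.prems by auto
    next
      case True
      then obtain i where i: "i < dist_to_P y" "z = w i" by auto
      then have i1: "dist_to_P y = Suc i" using w(6)[of i] dz by simp
      have "i \<noteq> 0" using i less.prems w(1) by metis
      have "(y, x j) \<notin> A" if "j \<le> k + 2" for j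
        using dist_to_P_1[of y j] that i1 \<open>i \<noteq> 0\<close> by auto
      then have "(x p, y) \<in> A" using all_in[of y p p] less.prems by auto
      moreover have "(y, z) \<in> A ^^ i"
        unfolding relpow_fun_conv using w i by (intro exI[of _ w]) auto
      \<comment> \<open>From \<open>x p\<close> to \<open>y\<close>, along the path to
        \<open>z\<close> and on to \<open>x (k + 1 + p)\<close> takes \<open>i + 2\<close> arcs,
        fewer than \<open>k + 1\<close>.\<close>
      ultimately have "(x p, z) \<in> A ^^ Suc i" by (rule relpow_Suc_I2)
      then have "(x p, x (k + 1 + p)) \<in> A ^^ Suc (Suc i)" using out[OF kp] by (rule relpow_Suc_I)
      from geodesic[OF _ kp(1) this] have "k + 1 + p \<le> p + Suc (Suc i)" using less.prems by simp
      then show False using small i1 by simp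
    qed
  qed
  \<comment> \<open>Arcs of the path end closer to \<open>P\<close> than \<open>y\<close>, so the
    induction hypothesis applies to them.\<close>
  have alt: "parity_type (p + j) (w j)" if "j < dist_to_P y" for j
  proof (rule alternating_types[of "dist_to_P y"])
    fix j q assume j: "Suc j < dist_to_P y" and q: "q \<le> 1" "parity_type q (w j)"
    have "w j \<noteq> w (Suc j)" using w(6)[of j] w(6)[of "Suc j"] j by force
    then show "\<not> parity_type q (w (Suc j))"
      using less.hyps[of "w (Suc j)" "w j" q] w(5,7)[of j] w(6,7)[of "Suc j"] q j by auto
  qed (use w less.prems that in auto)
  \<comment> \<open>\<open>w 1\<close> is too far from \<open>P\<close> to send an arc there, so it
    receives one from class \<open>p + 1\<close>. Two of the three cases below enter the path by
    this arc.\<close>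
  obtain c1 where c1: "c1 \<le> k + 2" "even (c1 + (p + 1))" "adjacent A (w 1) (x c1)"
    using alt[of 1] km k5 by (auto simp: parity_type_def)
  have "(w 1, x c1) \<notin> A" using dist_to_P_1[of "w 1" c1] c1 w(6)[of 1] km k5 by auto
  then have in1: "(x c1, w 1) \<in> A" using c1 by (simp add: adjacent_def)
  have zw: "z \<noteq> w i" if "i < k - 1" for i
  proof
    assume "z = w i"
    then have "dist_to_P y - i = 1" using w(6)[of i] that km dz by simp
    then show False using that km by linarith
  qed
  show False
  proof (cases "z = w (k - 1)")
    case True
    have "parity_type (c1 + k + length (map w [1..<k] @ [y])) (last (map w [1..<k] @ [y]))"
    proof (rule in_type)
      have "y \<notin> w ` {1..<k}"
      proof
        assume "y \<in> w ` {1..<k}"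
        then obtain i where "1 \<le> i" "i < k" "y = w i" by auto
        then show False using w(6)[of i] km by simp
      qed
      then show "dipath (map w [1..<k] @ [y])"
        using w(8)[of k 1] km k5 True less.prems
        by (auto simp: successively_append_iff last_map)
      show "set (map w [1..<k] @ [y]) \<inter> P = {}" using w(9)[of k 1] km less.prems by auto
    qed (use c1 in1 k5 in \<open>auto simp: hd_append hd_map\<close>)
    then show False using U[of y "c1 + k + k" p] less.prems c1 k5 by auto
  next
    case zk: False
    have "z \<noteq> w i" if "i < k" for i
      using zw[of i] zk that by (cases "i = k - 1") auto
    then have znot: "z \<notin> w ` {0..<k}" by (metis atLeastLessThan_iff imageE)
    have "adjacent A z (w (k - 1))"
      using w(1) w(8)[of k 0] km k5 less.prems znot
      by (intro kpath_adj[of "z # map w [0..<k]"]) (auto simp: hd_map last_map successively_Cons)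
    then consider "(z, w (k - 1)) \<in> A" | "(w (k - 1), z) \<in> A" by (auto simp: adjacent_def)
    then show False
    proof cases
      case 1
      \<comment> \<open>\<open>k - 1\<close> is even, so \<open>w (k - 1)\<close> has the type of
        \<open>z\<close>, and it is closer to \<open>P\<close> than \<open>y\<close>.\<close>
      have "parity_type p (w (k - 1))"
        using alt[of "k - 1"] parity_type_cong[of "p + (k - 1)" p] km k5 odd_k by auto
      moreover have "k - 1 < dist_to_P y" using km k5 by linarith
      moreover from this have "dist_to_P (w (k - 1)) < dist_to_P y" using w(6)[of "k - 1"] k5 by linarith
      ultimately show False
        using less.hyps[of "w (k - 1)" z p] less.prems(1,5,6) w(7)[of "k - 1"] zk 1 by blast
    next
      case 2
      have "parity_type (c1 + k + length (map w [1..<k] @ [z])) (last (map w [1..<k] @ [z]))"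
      proof (rule in_type)
        show "dipath (map w [1..<k] @ [z])"
          using w(8)[of k 1] km k5 2 znot
          by (auto simp: successively_append_iff last_map)
        show "set (map w [1..<k] @ [z]) \<inter> P = {}" using w(9)[of k 1] km less.prems by auto
      qed (use c1 in1 k5 in \<open>auto simp: hd_append hd_map\<close>)
      then show False using U[of z "c1 + k + k" p] less.prems c1 k5 by auto
    qed
  qed
qed


text \<open>On a shortest path from \<open>z\<close> to \<open>P\<close> both types propagate. Without an opposite pair, its
  second last vertex outside \<open>P\<close> receives arcs from all of \<open>P\<close> and its last one dominates \<open>P\<close>,
  a shortcut of length 3.\<close>

lemma opposite_pair_of_no_out:
  assumes z: "z \<in> W" "parity_type 0 z" "parity_type 1 z" and no_out: "\<And>i. i \<le> k + 2 \<Longrightarrow> (z, x i) \<notin> A"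
  shows "\<exists>y\<in>W. \<exists>i\<le>k + 2. \<exists>j\<le>k + 2. odd (i + j) \<and> (y, x i) \<in> A \<and> (x j, y) \<in> A"
proof (rule ccontr)
  assume "\<not> ?thesis"
  then have N: False if "y \<in> W" "i \<le> k + 2" "j \<le> k + 2" "odd (i + j)" "(y, x i) \<in> A" "(x j, y) \<in> A" for y i j
    using that by blast
  obtain w c where w: "w 0 = z" "c \<le> k + 2" "w (dist_to_P z) = x c" "0 < dist_to_P z"
    "\<And>i. i < dist_to_P z \<Longrightarrow> (w i, w (Suc i)) \<in> A"
    "\<And>i. i \<le> dist_to_P z \<Longrightarrow> dist_to_P (w i) = dist_to_P z - i"
    "\<And>i. i < dist_to_P z \<Longrightarrow> w i \<in> W"
    "\<And>i j. j \<le> dist_to_P z \<Longrightarrow> dipath (map w [i..<j])"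
    "\<And>i j. j \<le> dist_to_P z \<Longrightarrow> w ` {i..<j} \<inter> P = {}"
    using path_to_P[OF z(1)] by blast
  have "dist_to_P z \<noteq> 1"
  proof
    assume 1: "dist_to_P z = 1"
    then have "(z, x c) \<in> A" using w(1,3) w(5)[of 0] by simp
    then show False using no_out w(2) by simp
  qed
  then have "2 \<le> dist_to_P z" using w(4) by linarith
  then obtain m where m: "dist_to_P z = Suc (Suc m)" by (metis Suc_le_D Suc_le_mono numeral_2_eq_2)
  \<comment> \<open>Up to index \<open>m\<close> the distance to \<open>P\<close> is at least 2, so
    no arc leads there and the two types force arcs from all of \<open>P\<close>.\<close>
  have ins: "(x i, w j) \<in> A" if j: "j \<le> m" and t: "parity_type 0 (w j)" "parity_type 1 (w j)" and i: "i \<le> k + 2" for i j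
  proof -
    have no: "(w j, x e) \<notin> A" if "e \<le> k + 2" for e
      using dist_to_P_1[of "w j" e] that w(6)[of j] j m by auto
    have "w j \<notin> P" using w(7)[of j] j m by auto
    then show ?thesis
      using all_in[of "w j" 0 i] all_in[of "w j" 1 i] no t i by (cases "even i") auto
  qed
  have both: "j \<le> Suc m \<Longrightarrow> parity_type 0 (w j) \<and> parity_type 1 (w j)" for j
  proof (induction j)
    case 0
    then show ?case using z w by simp
  next
    case (Suc j)
    have "w j \<noteq> w (Suc j)" using w(6)[of j] w(6)[of "Suc j"] Suc.prems m by force
    \<comment> \<open>Entering \<open>w j\<close> from \<open>x 0\<close> and from
      \<open>x 1\<close> yields both classes.\<close>
    then have "parity_type (i + k + length [w j, w (Suc j)]) (last [w j, w (Suc j)])" if "i \<le> 1" for i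
      using ins[of j i] w(5,7)[of j] w(7)[of "Suc j"] Suc m that k5 by (intro in_type) auto
    from this[of 0] this[of 1] show ?case
      using odd_k parity_type_cong[of "k + 2" 1 "w (Suc j)"] parity_type_cong[of "1 + k + 2" 0 "w (Suc j)"] by simp
  qed
  let ?y = "w (Suc m)"
  have yW: "?y \<in> W" and yc: "(?y, x c) \<in> A" using w(5,7)[of "Suc m"] w(3) m by auto
  \<comment> \<open>The arc to \<open>x c\<close> and the absence of opposite pairs forbid arcs from
    class \<open>q\<close> to \<open>?y\<close>.\<close>
  define q where "q = (c + 1) mod 2"
  have q: "q \<le> 1" "odd (q + c)" unfolding q_def by auto
  have "q = 0 \<or> q = 1" using q by auto
  then have "parity_type q ?y" using both[of "Suc m"] by (elim disjE) simp_all
  moreover have "(x i, ?y) \<notin> A" if "i \<le> k + 2" "even (i + q)" for i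
    using N[OF yW w(2), of i] yc that q by auto
  ultimately have outq: "(?y, x i) \<in> A" if "i \<le> k + 2" "even (i + q)" for i
    using all_out[of ?y q i] yW q that by blast
  have "q \<le> k + 2" using q by simp
  then have "(x i, ?y) \<notin> A" if "i \<le> k + 2" for i
    using N[OF yW w(2), of i] N[OF yW \<open>q \<le> k + 2\<close>, of i] outq[of q] yc that q by auto
  then have "(?y, x (k + 2)) \<in> A"
    using all_out[of ?y 1 "k + 2"] yW both[of "Suc m"] odd_k by auto
  moreover have "(x 0, w m) \<in> A" "(w m, ?y) \<in> A"
    using ins[of m 0] both[of m] w(5)[of m] m by auto
  ultimately have "(x 0, x (k + 2)) \<in> A ^^ 3"
    by (auto simp: numeral_3_eq_3)
  then show False using geodesic[of 0 "k + 2" 3] k5 by simp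
qed

text \<open>If \<open>z\<close> has an out-arc to \<open>x i\<close> and an in-arc from
  \<open>x j\<close> of equal parity, a neighbour \<open>x a\<close> of the other parity forms an
  opposite pair with one of them, whatever the direction of its arc. The one-sided cases are dual to
  each other.\<close>

lemma opposite_pair_exists:
  assumes z: "z \<in> W" "parity_type 0 z" "parity_type 1 z"
  shows "\<exists>y\<in>W. \<exists>i\<le>k + 2. \<exists>j\<le>k + 2. odd (i + j) \<and> (y, x i) \<in> A \<and> (x j, y) \<in> A"
proof -
  consider "\<forall>i\<le>k + 2. (z, x i) \<notin> A" | "\<forall>i\<le>k + 2. (x i, z) \<notin> A"
    | i j where "i \<le> k + 2" "j \<le> k + 2" "(z, x i) \<in> A" "(x j, z) \<in> A" by blast
  then show ?thesis
  proof cases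
    case 1
    then show ?thesis using opposite_pair_of_no_out[OF z] by blast
  next
    case 2
    have "parity_type (Suc 0) z" "parity_type (Suc 1) z" using z parity_type_cong[of 0 2 z] by (auto simp: numeral_2_eq_2)
    then obtain y i j where y: "y \<in> W" "i \<le> k + 2" "j \<le> k + 2" "odd (i + j)"
      "(y, x (k + 2 - i)) \<in> A\<inverse>" "(x (k + 2 - j), y) \<in> A\<inverse>"
      using long_geodesic.opposite_pair_of_no_out[OF dual, of z] z(1) 2
      unfolding dual_P dual_parity_type by auto
    moreover have "odd (k + 2 - j + (k + 2 - i))" using y by presburger
    ultimately show ?thesis
      by (intro bexI[of _ y] exI[of _ "k + 2 - j"] conjI exI[of _ "k + 2 - i"]) auto
  next
    case 3
    obtain a where a: "a \<le> k + 2" "odd (a + i)" "adjacent A z (x a)"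
      using z unfolding parity_type_def by (cases "even i") fastforce+
    consider "odd (i + j)" | "odd (a + j)" "(z, x a) \<in> A" | "odd (i + a)" "(x a, z) \<in> A"
      using a by (auto simp: adjacent_def)
    then show ?thesis by cases (use z 3 a in blast)+
  qed
qed

lemma all_types:
  assumes "z \<in> W" "parity_type 0 z" "parity_type 1 z" and "w \<in> W"
  shows "parity_type q w"
proof -
  obtain y i j where y: "y \<in> W" "i \<le> k + 2" "j \<le> k + 2" "odd (i + j)" "(y, x i) \<in> A" "(x j, y) \<in> A"
    using opposite_pair_exists[OF assms(1-3)] by blast
  obtain p where "parity_type p w" using parity_type_exists[OF assms(4)] by blast
  then show ?thesis using both_types_of_opposite_pair[of w y p i j q] y assms(4) by blast
qed

subsection \<open>Adjacency of vertices of opposite types\<close>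

definition only_out :: "nat \<Rightarrow> 'a \<Rightarrow> bool" where
  "only_out p z \<longleftrightarrow> (\<forall>i\<le>k + 2. even (i + p) \<longrightarrow> (z, x i) \<in> A \<and> (x i, z) \<notin> A)"

definition only_in :: "nat \<Rightarrow> 'a \<Rightarrow> bool" where
  "only_in p z \<longleftrightarrow> (\<forall>i\<le>k + 2. even (i + p) \<longrightarrow> (z, x i) \<notin> A \<and> (x i, z) \<in> A)"

lemma dual_only_in:
  assumes "only_out p z"
  shows "long_geodesic.only_in (A\<inverse>) k (\<lambda>i. x (k + 2 - i)) (Suc p) z"
  unfolding long_geodesic.only_in_def[OF dual]
proof (intro allI impI)
  fix i assume i: "i \<le> k + 2" "even (i + Suc p)"
  then have "even (k + 2 - i + p)" using odd_k by auto
  then show "(z, x (k + 2 - i)) \<notin> A\<inverse> \<and> (x (k + 2 - i), z) \<in> A\<inverse>"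
    using assms unfolding only_out_def by auto
qed

text \<open>If one vertex is one-sided on its class, \<open>all_out_some_in_adj\<close> and
  \<open>all_in_some_out_adj\<close> pass this on to the other. Otherwise both have in- and out-arcs
  in their classes, and \<open>mixed_adj\<close> applies.\<close>

lemma nonadjacent_cases:
  assumes W: "z \<in> W" "w \<in> W" "z \<noteq> w" and p: "p \<le> 1" "q \<le> 1" "odd (p + q)"
    and types: "parity_type p z" "parity_type q w" and na: "\<not> adjacent A z w"
  shows "only_out p z \<and> only_out q w \<or> only_in p z \<and> only_in q w"
proof -
  have W': "z \<notin> P" "w \<notin> P" "w \<noteq> z" and na': "\<not> adjacent A w z" using W na adj_sym by auto
  have oz: "only_out p z \<or> (\<exists>i\<le>k + 2. even (i + p) \<and> (x i, z) \<in> A)"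
    unfolding only_out_def using all_out[OF W'(1) types(1)] p by blast
  have iz: "only_in p z \<or> (\<exists>i\<le>k + 2. even (i + p) \<and> (z, x i) \<in> A)"
    unfolding only_in_def using all_in[OF W'(1) types(1)] p by blast
  have ow: "only_out q w \<or> (\<exists>i\<le>k + 2. even (i + q) \<and> (x i, w) \<in> A)"
    unfolding only_out_def using all_out[OF W'(2) types(2)] p by blast
  have iw: "only_in q w \<or> (\<exists>i\<le>k + 2. even (i + q) \<and> (w, x i) \<in> A)"
    unfolding only_in_def using all_in[OF W'(2) types(2)] p by blast
  have par: "even (i + p) \<longleftrightarrow> odd (i + q)" for i using p by auto
  have 1: "only_out q w" if "only_out p z"
    using ow all_out_some_in_adj[OF W'(1,2) W(3), of p] that na par unfolding only_out_def by blast
  have 2: "only_out p z" if "only_out q w"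
    using oz all_out_some_in_adj[OF W'(2,1,3), of q] that na' par unfolding only_out_def by blast
  have 3: "only_in q w" if "only_in p z"
    using iw all_in_some_out_adj[OF W'(1,2) W(3), of p] that na par unfolding only_in_def by blast
  have 4: "only_in p z" if "only_in q w"
    using iz all_in_some_out_adj[OF W'(2,1,3), of q] that na' par unfolding only_in_def by blast
  show ?thesis
  proof (rule ccontr)
    assume "\<not> ?thesis"
    then obtain a b c d where *: "a \<le> k + 2" "even (a + p)" "(x a, z) \<in> A"
      "b \<le> k + 2" "even (b + p)" "(z, x b) \<in> A"
      "c \<le> k + 2" "even (c + q)" "(x c, w) \<in> A" "d \<le> k + 2" "even (d + q)" "(w, x d) \<in> A"
      using 1 2 3 4 oz iz ow iw by metis
    consider "p = 0" "q = 1" | "p = 1" "q = 0" using p by (cases "p = 0"; cases "q = 0") auto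
    then show False
      by cases (use * na na' mixed_adj[OF W'(1,2) W(3), of b a d c]
        mixed_adj[OF W'(2,1,3), of d c b a] in auto)
  qed
qed

text \<open>A shortest path from \<open>z\<close> to \<open>P\<close> is prolonged along the cycle
  and ends with an arc from \<open>P\<close> to \<open>w\<close>; if it is long, \<open>w\<close>
  follows its first \<open>k\<close> vertices directly. The distance condition keeps
  \<open>w\<close> off the path.\<close>

lemma only_in_adjacent:
  assumes w: "w \<in> W" "only_in q w" and p: "p \<le> 1" "q \<le> 1" "odd (p + q)"
  shows "z \<in> W \<Longrightarrow> z \<noteq> w \<Longrightarrow> only_in p z \<Longrightarrow> dist_to_P z \<le> dist_to_P w \<Longrightarrow> adjacent A z w"
proof (induction "dist_to_P z" arbitrary: z rule: less_induct)
  case less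
  have "(x q, w) \<in> A" "(x p, z) \<in> A"
    using w(2) less.prems(3) p unfolding only_in_def by auto
  then have tq: "parity_type q w" "parity_type p z"
    using p unfolding parity_type_def adjacent_def by (intro exI[of _ q], simp, intro exI[of _ p], simp)
  obtain v c where v: "v 0 = z" "c \<le> k + 2" "v (dist_to_P z) = x c" "0 < dist_to_P z"
    "\<And>i. i < dist_to_P z \<Longrightarrow> (v i, v (Suc i)) \<in> A"
    "\<And>i. i \<le> dist_to_P z \<Longrightarrow> dist_to_P (v i) = dist_to_P z - i"
    "\<And>i. i < dist_to_P z \<Longrightarrow> v i \<in> W"
    "\<And>i j. j \<le> dist_to_P z \<Longrightarrow> dipath (map v [i..<j])"
    "\<And>i j. j \<le> dist_to_P z \<Longrightarrow> v ` {i..<j} \<inter> P = {}"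
    using path_to_P[OF less.prems(1)] by blast
  have wv_ne: "w \<noteq> v i" if "i < dist_to_P z" for i
  proof
    assume "w = v i"
    then have "dist_to_P z \<le> dist_to_P z - i" using v(6)[of i] that less.prems by simp
    then have "i = 0" using v(4) by simp
    then show False using \<open>w = v i\<close> v(1) less.prems by simp
  qed
  then have wv: "w \<notin> v ` {0..<dist_to_P z}" by (metis atLeastLessThan_iff imageE)
  show ?case
  proof (cases "dist_to_P z < k")
    case True
    \<comment> \<open>The path to \<open>P\<close>, \<open>s\<close> arcs of the cycle and the last
      arc to \<open>w\<close> have total length \<open>k\<close>.\<close>
    define s where "s = k - 1 - dist_to_P z"
    have s: "s \<le> k + 2" "s + Suc (dist_to_P z) = k" using True unfolding s_def by auto
    obtain l c' where l: "dipath l" "length l = Suc s" "hd l = x c" "last l = x c'"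
      "set l \<subseteq> P" "c' \<le> k + 2" "even (c + s + c')"
      using cycle_list[OF v(2) s(1)] .
    have "l \<noteq> []" using l by auto
    have adj: "adjacent A z w" if "(x c', w) \<in> A"
    proof (rule kpath_adj[of "map v [0..<dist_to_P z] @ l @ [w]"])
      have "v ` {0..<dist_to_P z} \<inter> set l = {}" using v(9)[of "dist_to_P z" 0] l(5) by blast
      moreover have "w \<notin> set l" using w(1) l(5) by blast
      ultimately show "dipath (map v [0..<dist_to_P z] @ l @ [w])"
        using v(4) v(5)[of "dist_to_P z - 1"] v(3) v(8)[of "dist_to_P z" 0] l w wv that \<open>l \<noteq> []\<close>
        by (auto simp: successively_append_iff last_map)
    qed (use v s l in \<open>auto simp: hd_append hd_map\<close>)
    show ?thesis
    proof (cases "even (c' + q)")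
      case True
      then show ?thesis using adj w(2) l unfolding only_in_def by blast
    next
      case False
      \<comment> \<open>The wrong parity of \<open>c'\<close> means that \<open>z\<close> also has
        type \<open>q\<close>. Then every outside vertex has both types, and the classes of
        \<open>z\<close> and \<open>w\<close> can be exchanged.\<close>
      have "parity_type (c + k + length (map v [0..<dist_to_P z])) (hd (map v [0..<dist_to_P z]))"
        using v True v(5)[of "dist_to_P z - 1"] v(8)[of "dist_to_P z" 0] v(9)[of "dist_to_P z" 0] \<open>dist_to_P z < k\<close>
        by (intro out_type) (auto simp: last_map)
      then have "parity_type (c + k + dist_to_P z) z" using v by (simp add: hd_map)
      moreover have "even (s + dist_to_P z)" using s(2) odd_k by (metis add_Suc_right even_Suc)
      then have "even (c + k + dist_to_P z + q)" using False l(7) odd_k by auto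
      ultimately have tz: "parity_type q z" using parity_type_cong by blast
      have "p = 0 \<and> q = 1 \<or> p = 1 \<and> q = 0" using p by (cases "p = 0"; cases "q = 0") auto
      then have both: "parity_type 0 z" "parity_type 1 z" using tq(2) tz by auto
      then have tw: "parity_type p w" using all_types[OF less.prems(1) _ _ w(1)] by blast
      show ?thesis
      proof (rule ccontr)
        assume na: "\<not> ?thesis"
        have "odd (q + p)" using p by simp
        from nonadjacent_cases[OF less.prems(1) w(1) less.prems(2) p(2,1) this tz tw na]
        show False
        proof (elim disjE conjE)
          assume "only_out q z"
          then have "(z, x (k + 1 + q)) \<in> A" unfolding only_out_def using p odd_k by auto
          moreover have "(x p, z) \<in> A" using less.prems(3) p unfolding only_in_def by auto
          ultimately show False using gap[of "k + 1 + q" p z] p k5 by simp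
        next
          assume "only_in p w"
          moreover have "even (c' + p)" using False p by auto
          ultimately show False using adj na l unfolding only_in_def by blast
        qed
      qed
    qed
  next
    case False
    \<comment> \<open>\<open>k - 1\<close> is even, so \<open>?y\<close> has the type of
      \<open>z\<close>; an arc from \<open>?y\<close> to \<open>w\<close> completes a path of length
      \<open>k\<close>.\<close>
    let ?y = "v (k - 1)"
    have k1: "k - 1 < dist_to_P z" using False k5 by linarith
    then have y: "?y \<in> W" "dist_to_P ?y = dist_to_P z - (k - 1)" "?y \<noteq> w"
      using v(6,7)[of "k - 1"] wv_ne[of "k - 1"] by auto
    from y(2) have dy: "dist_to_P ?y < dist_to_P z" "Suc (dist_to_P ?y) < dist_to_P z"
      using False k5 by linarith+
    have py: "parity_type p ?y"
    proof (cases "\<exists>z\<in>W. parity_type 0 z \<and> parity_type 1 z")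
      case True
      then show ?thesis using all_types y(1) by blast
    next
      case B: False
      have "parity_type (p + (k - 1)) ?y"
      proof (rule alternating_types[of "dist_to_P z"])
        fix j r assume j: "Suc j < dist_to_P z" and r: "r \<le> 1" "parity_type r (v j)"
        have "v j \<noteq> v (Suc j)" using v(6)[of j] v(6)[of "Suc j"] j by force
        then show "\<not> parity_type r (v (Suc j))"
          using arc_types[of "v j" "v (Suc j)" r] B v(5,7)[of j] v(7)[of "Suc j"] r j by auto
      qed (use v tq k1 in auto)
      then show ?thesis using parity_type_cong[of "p + (k - 1)" p] odd_k k5 by auto
    qed
    have "adjacent A ?y w"
    proof (rule ccontr)
      assume na: "\<not> ?thesis"
      from nonadjacent_cases[OF y(1) w(1) y(3) p py tq(1) na]
      show False
      proof (elim disjE conjE)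
        assume "only_out q w"
        then have "(w, x q) \<in> A" using p unfolding only_out_def by auto
        moreover have "(w, x q) \<notin> A" using w(2) p unfolding only_in_def by auto
        ultimately show False by simp
      next
        assume "only_in p ?y"
        then have "adjacent A ?y w"
          using less.hyps[of ?y] y dy(1) less.prems(4) by simp
        then show False using na by simp
      qed
    qed
    moreover have "(w, ?y) \<notin> A" using dist_to_P_arc[of w ?y] dy(2) less.prems(4) by auto
    ultimately have yw: "(?y, w) \<in> A" by (simp add: adjacent_def)
    show ?thesis
    proof (rule kpath_adj[of "map v [0..<k] @ [w]"])
      have "w \<notin> v ` {0..<k}"
      proof
        assume "w \<in> v ` {0..<k}"
        then obtain i where "i < k" "w = v i" by auto
        then show False using wv_ne[of i] False by simp
      qed
      then show "dipath (map v [0..<k] @ [w])"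
        using v(8)[of k 0] yw False k5 by (auto simp: successively_append_iff last_map)
    qed (use v k5 in \<open>auto simp: hd_append hd_map\<close>)
  qed
qed

text \<open>The distance condition of \<open>only_in_adjacent\<close> holds after possibly
  exchanging the vertices. The \<open>only_out\<close> case is treated in the reversed digraph, with
  distances from \<open>P\<close>.\<close>

lemma opposite_types_adjacent:
  assumes zw: "z \<in> W" "w \<in> W" "z \<noteq> w" "parity_type 0 z" "parity_type 1 w"
  shows "adjacent A z w"
proof (rule ccontr)
  assume na: "\<not> ?thesis"
  then have na': "\<not> adjacent A w z" using adj_sym by blast
  consider "only_out 0 z" "only_out 1 w" | "only_in 0 z" "only_in 1 w"
    using nonadjacent_cases[OF zw(1-3), of 0 1] zw(4,5) na by auto
  then show False
  proof cases
    case 1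
    interpret d: long_geodesic V "A\<inverse>" k "\<lambda>i. x (k + 2 - i)" by (rule dual)
    have "d.only_in 1 z" "d.only_in 0 w"
      using dual_only_in[OF 1(1)] dual_only_in[OF 1(2)]
      unfolding d.only_in_def by simp_all
    then show False
      using d.only_in_adjacent[of w 0 1 z] d.only_in_adjacent[of z 1 0 w] zw na na'
      unfolding dual_P dual_adjacent by (cases "d.dist_to_P z \<le> d.dist_to_P w") auto
  next
    case 2
    then show False
      using only_in_adjacent[of w 1 0 z] only_in_adjacent[of z 0 1 w] zw na na'
      by (cases "dist_to_P z \<le> dist_to_P w") auto
  qed
qed

text \<open>\<open>X\<close> or \<open>Y\<close> may be empty, which accounts for the empty digraph.
  Pairs with \<open>z = w\<close> are left out because the locale does not exclude loops.\<close>

lemma outside_structure: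
  "(\<forall>z\<in>W. \<forall>w\<in>W. z \<noteq> w \<longrightarrow> adjacent A z w) \<or>
   (\<exists>X Y. X \<union> Y = W \<and> X \<inter> Y = {} \<and> (\<forall>z\<in>X. \<forall>w\<in>X. z \<noteq> w \<longrightarrow> \<not> adjacent A z w) \<and>
     (\<forall>z\<in>Y. \<forall>w\<in>Y. z \<noteq> w \<longrightarrow> \<not> adjacent A z w) \<and> (\<forall>z\<in>X. \<forall>w\<in>Y. adjacent A z w))"
proof (cases "\<exists>z\<in>W. parity_type 0 z \<and> parity_type 1 z")
  case True
  then obtain y where y: "y \<in> W" "parity_type 0 y" "parity_type 1 y" by blast
  show ?thesis
  proof (intro disjI1 ballI impI)
    fix z w assume "z \<in> W" "w \<in> W" "z \<noteq> w"
    then show "adjacent A z w" using opposite_types_adjacent all_types[OF y] by simp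
  qed
next
  case False
  have same: "\<not> adjacent A z w" if "z \<in> W" "w \<in> W" "z \<noteq> w" "parity_type p z" "parity_type p w" "p \<le> 1" for z w p
    using arc_types[of z w p] arc_types[of w z p] False that unfolding adjacent_def by blast
  have "parity_type 0 z \<or> parity_type 1 z" if "z \<in> W" for z using parity_type_Suc[OF that, of 0] by auto
  then have "{z \<in> W. parity_type 0 z} \<union> {z \<in> W. parity_type 1 z} = W" by blast
  moreover have "{z \<in> W. parity_type 0 z} \<inter> {z \<in> W. parity_type 1 z} = {}" using False by blast
  moreover have "adjacent A z w" if "z \<in> W" "parity_type 0 z" "w \<in> W" "parity_type 1 w" for z w
    using opposite_types_adjacent[of z w] False that by blast
  ultimately show ?thesis using same[of _ _ 0] same[of _ _ 1]
    by (intro disjI2 exI[of _ "{z \<in> W. parity_type 0 z}"] exI[of _ "{z \<in> W. parity_type 1 z}"]) auto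
qed

end

section \<open>Paths, walks and the final theorem\<close>

lemma is_path_iff:
  "is_path A p \<longleftrightarrow> p \<noteq> [] \<and> distinct p \<and> successively (\<lambda>a b. (a, b) \<in> A) p"
  by (auto simp: is_path_def successively_conv_nth)

lemma path_of_walk:
  "(a, b) \<in> A ^^ n \<Longrightarrow> \<exists>p. is_path_from_to A a b p \<and> path_len p \<le> n"
proof (induction n arbitrary: a)
  case 0
  then show ?case
    by (intro exI[of _ "[a]"]) (auto simp: is_path_from_to_def is_path_iff path_len_def)
next
  case (Suc n)
  then obtain y where y: "(a, y) \<in> A" "(y, b) \<in> A ^^ n" using relpow_Suc_D2 by metis
  then obtain p where p: "is_path_from_to A y b p" "path_len p \<le> n" using Suc.IH by blast
  show ?case
  proof (cases "a \<in> set p")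
    case False
    then show ?thesis using p y
      by (intro exI[of _ "a # p"])
        (auto simp: is_path_from_to_def is_path_iff path_len_def successively_Cons)
  next
    case True
    then obtain p1 p2 where "p = p1 @ a # p2" by (auto dest: split_list)
    then show ?thesis using p
      by (intro exI[of _ "a # p2"])
        (auto simp: is_path_from_to_def is_path_iff path_len_def successively_append_iff)
  qed
qed

lemma dist_le_walk: "(a, b) \<in> A ^^ n \<Longrightarrow> dist A a b \<le> n"
proof -
  assume "(a, b) \<in> A ^^ n"
  from path_of_walk[OF this] obtain p where p: "is_path_from_to A a b p" "path_len p \<le> n" by blast
  then have "dist A a b \<le> path_len p" unfolding dist_def by (intro Least_le) auto
  then show ?thesis using p by simp
qed

lemma walk_of_path:
  assumes "is_path A p" "i \<le> j" "j < length p"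
  shows "(p ! i, p ! j) \<in> A ^^ (j - i)"
  unfolding relpow_fun_conv
proof (intro exI[of _ "\<lambda>t. p ! (i + t)"] conjI allI impI)
  fix t assume "t < j - i"
  then have "Suc (i + t) < length p" using assms by simp
  then show "(p ! (i + t), p ! (i + Suc t)) \<in> A" using assms(1) by (simp add: is_path_def)
qed (use assms in auto)

theorem theorem2p15:
  fixes V :: "'a set" and A :: "('a \<times> 'a) set" and k :: nat and u v :: 'a and P :: "'a list"
  assumes "digraph V A"
    and "odd k" and "k \<ge> 5"
    and "strong V A"
    and "k_quasi_transitive k V A"
    and "diam V A \<ge> k + 2"
    and "u \<in> V" and "v \<in> V" and "dist A u v = k + 2"
    and "is_shortest_path A u v P"
  shows "semicomplete (V - set P) (induced_arcs A (V - set P))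
       \<or> semicomplete_bipartite (V - set P) (induced_arcs A (V - set P))
       \<or> empty_digraph (V - set P) (induced_arcs A (V - set P))"
proof -
  have dg: "A \<subseteq> V \<times> V" "\<And>y. (y, y) \<notin> A" using assms(1) by (auto simp: digraph_def)
  have P: "is_path A P" "hd P = u" "last P = v" "length P = k + 3"
    using assms(9,10)
    by (auto simp: is_shortest_path_def is_path_from_to_def path_len_def)
  have ends: "P ! 0 = u" "P ! (k + 2) = v"
    using P by (auto simp: hd_conv_nth last_conv_nth is_path_def)
  interpret long_geodesic V A k "\<lambda>i. P ! i"
  proof
    show "A \<subseteq> V \<times> V" "odd k" "5 \<le> k" by fact+
    show arc: "(P ! i, P ! Suc i) \<in> A" if "i < k + 2" for i
      using P that by (auto simp: is_path_def)
    show "P ! i \<in> V" if "i \<le> k + 2" for i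
      using arc[of i] dg(1) ends(2) assms(8) that by (cases "i = k + 2") auto
    show "j \<le> i + n" if "i \<le> k + 2" "j \<le> k + 2" "(P ! i, P ! j) \<in> A ^^ n" for i j n
    proof -
      have "(u, P ! i) \<in> A ^^ i" using walk_of_path[OF P(1), of 0 i] P ends that by simp
      moreover have "(P ! j, v) \<in> A ^^ (k + 2 - j)"
        using walk_of_path[OF P(1), of j "k + 2"] P ends that by simp
      \<comment> \<open>The start of \<open>P\<close>, the given walk and the end of
        \<open>P\<close> join to a walk from \<open>u\<close> to \<open>v\<close>, which has at
        least \<open>k + 2\<close> arcs.\<close>
      ultimately have "(u, v) \<in> A ^^ (i + n + (k + 2 - j))"
        using that(3) relpow_trans by metis
      then show ?thesis using dist_le_walk assms(9) that by fastforce
    qed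
    show "adjacent A (hd l) (last l)"
      if "distinct l" "successively (\<lambda>a b. (a, b) \<in> A) l" "length l = Suc k" for l
    proof -
      have "is_path A l \<and> path_len l = k" using that by (auto simp: is_path_iff path_len_def)
      then show ?thesis using assms(5) unfolding k_quasi_transitive_def by blast
    qed
    show "(a, b) \<in> A\<^sup>*" if ab: "a \<in> V" "b \<in> V" for a b
    proof -
      obtain p where "is_path_from_to A a b p" using assms(4) ab unfolding strong_def by blast
      then have "(a, b) \<in> A ^^ (length p - 1)"
        using walk_of_path[of A p 0 "length p - 1"]
        by (auto simp: is_path_from_to_def is_path_def hd_conv_nth last_conv_nth)
      then show ?thesis by (rule relpow_imp_rtrancl)
    qed
  qed
  have setP: "set P = (\<lambda>i. P ! i) ` {..k + 2}"
    using P by (auto simp: set_conv_nth)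
  let ?W = "V - set P"
  have ind: "adjacent (induced_arcs A ?W) a b \<longleftrightarrow> adjacent A a b" if "a \<in> ?W" "b \<in> ?W" for a b
    using that by (auto simp: adjacent_def induced_arcs_def)
  have irrefl: "\<not> adjacent A a a" for a using dg(2) by (auto simp: adjacent_def)
  from outside_structure[folded setP] show ?thesis
  proof (elim disjE exE conjE)
    assume "\<forall>z\<in>?W. \<forall>w\<in>?W. z \<noteq> w \<longrightarrow> adjacent A z w"
    then show ?thesis by (simp add: semicomplete_def ind)
  next
    fix X Y
    assume XY: "X \<union> Y = ?W" "X \<inter> Y = {}" "\<forall>z\<in>X. \<forall>w\<in>X. z \<noteq> w \<longrightarrow> \<not> adjacent A z w"
      "\<forall>z\<in>Y. \<forall>w\<in>Y. z \<noteq> w \<longrightarrow> \<not> adjacent A z w" "\<forall>z\<in>X. \<forall>w\<in>Y. adjacent A z w"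
    have sub: "X \<subseteq> ?W" "Y \<subseteq> ?W" using XY(1) by auto
    show ?thesis
    proof (cases "X = {} \<or> Y = {}")
      case True
      then have "\<not> adjacent A z w" if "z \<in> ?W" "w \<in> ?W" for z w
        using XY irrefl that by (cases "z = w") auto
      then have "induced_arcs A ?W = {}" by (auto simp: induced_arcs_def adjacent_def)
      then show ?thesis by (simp add: empty_digraph_def)
    next
      case False
      have "semicomplete_bipartite ?W (induced_arcs A ?W)"
      proof -
        have "\<not> adjacent (induced_arcs A ?W) z w" if "z \<in> X" "w \<in> X" for z w
          using that sub ind[of z w] XY(3) irrefl by (cases "z = w") auto
        moreover have "\<not> adjacent (induced_arcs A ?W) z w" if "z \<in> Y" "w \<in> Y" for z w
          using that sub ind[of z w] XY(4) irrefl by (cases "z = w") auto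
        moreover have "adjacent (induced_arcs A ?W) z w" if "z \<in> X" "w \<in> Y" for z w
          using that sub ind[of z w] XY(5) by auto
        ultimately show ?thesis
          unfolding semicomplete_bipartite_def using XY(1,2) False
          by (intro exI[of _ X] exI[of _ Y]) auto
      qed
      then show ?thesis by simp
    qed
  qed
qed

end
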